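(* Assume that $\mathbb E\exp(a_0K)<\infty$ for some $a_0>0$. Then the decay of the probability that all servers are reached before exhaustion is exponential and given by $$\lim_{n\to+\infty}n^{-1}\ln\mathbb P(\mathrm{Trans}_n)=-\inf_{s\ge0}\Big\{I(\lambda(s))+(\lambda(s)-1)\ln(1-e^{-s})+\lambda(s)e^{-s}\Big\},$$ with $\lambda(s)=s/(1-e^{-s})$ for $s>0$ and $\lambda(0)=1$ (at $s=0$ the middle term is taken to be $0$). The right-hand side above is negative.
   Context: $\mathbb N=\{0,1,2,\dots\}$; $K$ is a generic random variable with law $\mu$ on $\mathbb N$, with $\mu(0)<1$ and $\mu(1)<1$. $I(u)=\sup_{a\in\mathbb R}\{au-\ln\mathbb E\exp(aK)\}\in[0,\infty]$ for $u\ge 0$. For each $n\ge1$, $(N_n(t),S_n(t))_{t\in\mathbb N}$ is the Markov chain with $N_n(0)=1$, $S_n(0)\sim\mu$, absorbed when $S_n=0$, and such that, as long as $S_n(t)>0$, conditionally on the past up to time $t$: with probability $N_n(t)/n$, $(N_n(t+1),S_n(t+1))=(N_n(t),S_n(t)-1)$; with probability $1-N_n(t)/n$, $(N_n(t+1),S_n(t+1))=(N_n(t)+1,S_n(t)+K(t+1)-1)$, where $K(t+1)\sim\mu$ is independent of the past up to time $t$. $\tau_n=\min\{t\in\mathbb N:S_n(t)=0\}$ and $\mathrm{Trans}_n=\{N_n(\tau_n)=n\}$. *)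

theory Defs
  imports "HOL-Probability.Probability"
begin

text \<open>Extended logarithm, with \<open>ln 0 = -\<infinity>\<close> and \<open>ln \<infinity> = \<infinity>\<close>.\<close>

definition eln :: "ennreal \<Rightarrow> ereal" where
  "eln x = (if x = 0 then -\<infinity> else if x = \<top> then \<infinity> else ereal (ln (enn2real x)))"

text \<open>\<open>exp_moment \<mu> a\<close> is the expectation of \<open>exp (a K)\<close> for \<open>K\<close> of law \<open>\<mu>\<close>; it may be infinite.\<close>

definition exp_moment :: "nat pmf \<Rightarrow> real \<Rightarrow> ennreal" where
  "exp_moment \<mu> a = (\<integral>\<^sup>+ k. ennreal (exp (a * real k)) \<partial>measure_pmf \<mu>)"

definition rate_fun :: "nat pmf \<Rightarrow> real \<Rightarrow> ereal" where
  "rate_fun \<mu> u = (SUP a::real. ereal (a * u) - eln (exp_moment \<mu> a))"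

definition lam :: "real \<Rightarrow> real" where
  "lam s = (if s = 0 then 1 else s / (1 - exp (- s)))"

text \<open>The middle term is \<open>0\<close> at \<open>s = 0\<close>, because \<open>lam 0 - 1 = 0\<close>.\<close>

definition trans_rate :: "nat pmf \<Rightarrow> ereal" where
  "trans_rate \<mu> =
     (INF s\<in>{0::real..}.
        rate_fun \<mu> (lam s) + ereal ((lam s - 1) * ln (1 - exp (- s)) + lam s * exp (- s)))"

text \<open>
  Transition law from the state \<open>(N, S)\<close>. The value \<open>True\<close> of the Bernoulli variable, of
  probability \<open>N / n\<close>, is the case where no new server is reached. States with \<open>N > n\<close> are not
  accessible from \<open>N = 1 \<le> n\<close>. In both cases \<open>S > 0\<close>, so the subtraction does not truncate.
\<close>

definition step :: "nat \<Rightarrow> nat pmf \<Rightarrow> nat \<times> nat \<Rightarrow> (nat \<times> nat) pmf" where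
  "step n \<mu> = (\<lambda>(N, S).
     if S = 0 then return_pmf (N, S)
     else bind_pmf (bernoulli_pmf (real N / real n))
            (\<lambda>b. if b then return_pmf (N, S - 1)
                 else map_pmf (\<lambda>k. (N + 1, S + k - 1)) \<mu>))"

locale server_chain = prob_space M
  for M :: "'a measure" and n :: nat and \<mu> :: "nat pmf"
    and N S :: "nat \<Rightarrow> 'a \<Rightarrow> nat" +
  assumes measurable_N: "\<And>t. N t \<in> measurable M (count_space UNIV)"
    and measurable_S: "\<And>t. S t \<in> measurable M (count_space UNIV)"
    and N_init: "AE \<omega> in M. N 0 \<omega> = 1"
    and S_init: "distr M (count_space UNIV) (S 0) = measure_pmf \<mu>"
    and transition:
      "\<And>t x y. \<P>(\<omega> in M. \<forall>i\<le>t. (N i \<omega>, S i \<omega>) = x i) > 0 \<Longrightarrow>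
         \<P>(\<omega> in M. (N (t + 1) \<omega>, S (t + 1) \<omega>) = y \<bar> \<forall>i\<le>t. (N i \<omega>, S i \<omega>) = x i)
           = pmf (step n \<mu> (x t)) y"

text \<open>
  The event \<open>N \<tau> = n\<close>, where \<open>\<tau>\<close> is the first hitting time of \<open>0\<close> by \<open>S\<close>. Paths on which \<open>S\<close>
  never hits \<open>0\<close>, a null event for \<open>server_chain\<close> with \<open>n \<ge> 1\<close>, are excluded.
\<close>

definition Trans ::
  "'a measure \<Rightarrow> nat \<Rightarrow> (nat \<Rightarrow> 'a \<Rightarrow> nat) \<Rightarrow> (nat \<Rightarrow> 'a \<Rightarrow> nat) \<Rightarrow> 'a set" where
  "Trans M n N S =
     {\<omega> \<in> space M. (\<exists>t. S t \<omega> = 0) \<and> N (LEAST t. S t \<omega> = 0) \<omega> = n}"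

end

theory Submission
  imports Defs "HOL-Computational_Algebra.Formal_Power_Series" "HOL-Real_Asymp.Real_Asymp"
begin

text \<open>
  The servers are reached as in a coupon collector's problem, and \<open>Trans\<close> occurs exactly when, for each
  \<open>j < n\<close>, the first \<open>j\<close> variables \<open>K\<close> sum up to at least the number of draws needed to reach server \<open>j + 1\<close>.
  Keeping only \<open>j = n - 1\<close> bounds the probability from above. Conversely, if only the last constraint holds,
  a cyclic shift of the sequence of \<open>K\<close>'s and a cyclic shift of the word of draws make every prefix as good
  as average, so all constraints hold at a polynomial cost. Up to polynomial factors the probability is
  therefore the maximum over \<open>k\<close> of the product of the probability that \<open>n - 1\<close> copies of \<open>K\<close> have sum
  at least \<open>k\<close> and the probability that \<open>k\<close> draws reach all servers. The former is governed by Cramer's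
  theorem. The latter is a coefficient of \<open>exp z * (exp z - 1) ^ (n - 1)\<close>, bounded above by the value of
  this series at a saddle point \<open>s\<close> and below by a law of large numbers for its coefficients tilted at \<open>s\<close>;
  the number of draws per server at the saddle point is \<open>lam s\<close>.
\<close>

subsection \<open>The law of the chain\<close>

text \<open>The two bounds meet although they use different events. Above, the total of the
  \<open>K\<close>'s is split by its exact value \<open>k\<close>: a Chernoff bound for one atom
  works for every real \<open>a\<close>, so the full transform \<open>rate_fun\<close> appears even
  below the mean. Totals below \<open>n - 1\<close> contribute nothing, and \<open>lam\<close> maps
  \<open>[0, \<infinity>)\<close> onto \<open>[1, \<infinity>)\<close>, hence the parametrisation by
  \<open>s\<close>. Below, a tail event suffices. One concentration lemma for powers of a power
  series serves both lower bounds, but it only finds some index in a window; as both probabilities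
  are monotone in the threshold, it is applied at a slightly displaced point (\<open>r < s\<close>
  for the draws, \<open>u1 > u\<close> for the sums). For the sums the optimal tilt need not exist:
  exponential moments may be infinite for large \<open>a\<close>, and the supremum may be approached
  only as \<open>a\<close> tends to infinity. The sign of the limit needs care too:
  \<open>coupon_rate\<close> is positive but tends to \<open>0\<close> as \<open>s\<close> grows,
  and there the exponential moment of \<open>K\<close>, through linear growth of
  \<open>rate_fun\<close>, keeps the sum away from \<open>0\<close>.\<close>

lemma step_full:
  assumes "n \<ge> 1"
  shows "step n \<mu> (n, s) = return_pmf (n, s - 1)"
proof -
  have "bernoulli_pmf 1 = return_pmf True"
    by (rule pmf_eqI) (auto simp: indicator_def split: bool.splits)
  then show ?thesis using assms by (simp add: step_def bind_return_pmf)
qed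

text \<open>The locale prescribes conditional laws given the whole past, so the object determined by
  recursion is the law of the trajectory, not only that of the current state.\<close>

primrec hist_law :: "nat \<Rightarrow> nat pmf \<Rightarrow> nat \<Rightarrow> (nat \<times> nat) list pmf" where
  "hist_law n \<mu> 0 = map_pmf (\<lambda>k. [(1, k)]) \<mu>"
| "hist_law n \<mu> (Suc t) =
     bind_pmf (hist_law n \<mu> t) (\<lambda>h. map_pmf (\<lambda>y. h @ [y]) (step n \<mu> (last h)))"

lemma length_hist_law: "h \<in> set_pmf (hist_law n \<mu> t) \<Longrightarrow> length h = Suc t"
  by (induction t arbitrary: h) auto

lemma hist_law_steps:
  "h \<in> set_pmf (hist_law n \<mu> t) \<Longrightarrow> i < t \<Longrightarrow> h ! Suc i \<in> set_pmf (step n \<mu> (h ! i))"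
proof (induction t arbitrary: h)
  case (Suc t)
  then obtain g y where g: "g \<in> set_pmf (hist_law n \<mu> t)" "y \<in> set_pmf (step n \<mu> (last g))" "h = g @ [y]"
    by auto
  have len: "length g = Suc t" using length_hist_law[OF g(1)] .
  show ?case
  proof (cases "i < t")
    case True
    then show ?thesis using Suc.IH[OF g(1)] len g by (simp add: nth_append)
  next
    case False
    then have "i = t" using Suc.prems by simp
    then show ?thesis using g len by (cases g rule: rev_cases) (auto simp: nth_append)
  qed
qed simp

context server_chain
begin

definition hist :: "nat \<Rightarrow> 'a \<Rightarrow> (nat \<times> nat) list" where
  "hist t \<omega> = map (\<lambda>i. (N i \<omega>, S i \<omega>)) [0..<Suc t]"

lemma hist_eq_iff:
  "length h = Suc t \<Longrightarrow> hist t \<omega> = h \<longleftrightarrow> (\<forall>i\<le>t. (N i \<omega>, S i \<omega>) = h ! i)"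
  unfolding hist_def by (auto simp: list_eq_iff_nth_eq less_Suc_eq_le simp del: upt_Suc)

lemma length_hist: "length (hist t \<omega>) = Suc t"
  by (simp add: hist_def)

lemma hist_Suc: "hist (Suc t) \<omega> = hist t \<omega> @ [(N (Suc t) \<omega>, S (Suc t) \<omega>)]"
  by (simp add: hist_def)

lemma sets_N [measurable]: "{\<omega> \<in> space M. P (N t \<omega>)} \<in> sets M"
proof -
  have "N t -` {x. P x} \<inter> space M \<in> sets M"
    by (rule measurable_sets[OF measurable_N]) simp
  then show ?thesis by (simp add: vimage_def Int_def conj_commute)
qed

lemma sets_S [measurable]: "{\<omega> \<in> space M. P (S t \<omega>)} \<in> sets M"
proof -
  have "S t -` {x. P x} \<inter> space M \<in> sets M"
    by (rule measurable_sets[OF measurable_S]) simp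
  then show ?thesis by (simp add: vimage_def Int_def conj_commute)
qed

lemma sets_NS: "{\<omega> \<in> space M. (N t \<omega>, S t \<omega>) = x} \<in> sets M"
proof -
  have "{\<omega> \<in> space M. (N t \<omega>, S t \<omega>) = x} =
      {\<omega> \<in> space M. N t \<omega> = fst x} \<inter> {\<omega> \<in> space M. S t \<omega> = snd x}" by auto
  then show ?thesis by auto
qed

lemma hist_measurable: "hist t \<in> measurable M (count_space UNIV)"
proof (subst measurable_count_space_eq_countable[OF countableI_type], intro conjI ballI)
  fix h :: "(nat \<times> nat) list"
  show "hist t -` {h} \<inter> space M \<in> sets M"
  proof (cases "length h = Suc t")
    case True
    have "hist t -` {h} \<inter> space M = (\<Inter>i\<in>{..t}. {\<omega> \<in> space M. (N i \<omega>, S i \<omega>) = h ! i})"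
      using hist_eq_iff[OF True] by auto
    also have "\<dots> \<in> sets M" using sets_NS by (intro sets.finite_INT) auto
    finally show ?thesis .
  next
    case False
    then have "hist t -` {h} \<inter> space M = {}" by (auto simp: hist_def simp del: upt_Suc)
    then show ?thesis by simp
  qed
qed auto

text \<open>Chain rule, atom by atom: \<open>transition\<close> is a statement about single
  histories, and histories form a countable set.\<close>

lemma emeasure_hist: "emeasure M {\<omega> \<in> space M. hist t \<omega> = h} = pmf (hist_law n \<mu> t) h"
proof (induction t arbitrary: h)
  case 0
  show ?case
  proof (cases "\<exists>k. h = [(1, k)]")
    case True
    then obtain k where k: "h = [(1, k)]" by blast
    have "emeasure M {\<omega> \<in> space M. hist 0 \<omega> = h} = emeasure M {\<omega> \<in> space M. S 0 \<omega> = k}"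
    proof (rule emeasure_eq_AE)
      show "AE x in M. (x \<in> {\<omega> \<in> space M. hist 0 \<omega> = h}) = (x \<in> {\<omega> \<in> space M. S 0 \<omega> = k})"
        using N_init by eventually_elim (auto simp: hist_def k)
      show "{\<omega> \<in> space M. hist 0 \<omega> = h} \<in> sets M"
        using measurable_sets[OF hist_measurable, of "{h}"] by (simp add: vimage_def Int_def conj_commute)
    qed auto
    also have "\<dots> = emeasure (distr M (count_space UNIV) (S 0)) {k}"
      by (subst emeasure_distr[OF measurable_S]) (auto intro!: arg_cong[where f="emeasure M"])
    also have "\<dots> = pmf \<mu> k" by (simp add: S_init emeasure_pmf_single)
    also have "pmf \<mu> k = pmf (map_pmf (\<lambda>k. [(1::nat, k)]) \<mu>) [(1, k)]"
      by (rule pmf_map_inj'[symmetric]) (auto simp: inj_def)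
    finally show ?thesis by (simp add: k)
  next
    case False
    then have "pmf (hist_law n \<mu> 0) h = 0" by (auto simp: pmf_eq_0_set_pmf)
    moreover have "emeasure M {\<omega> \<in> space M. hist 0 \<omega> = h} = emeasure M {}"
    proof (rule emeasure_eq_AE)
      show "AE x in M. (x \<in> {\<omega> \<in> space M. hist 0 \<omega> = h}) = (x \<in> {})"
        using N_init by eventually_elim (use False in \<open>auto simp: hist_def\<close>)
      show "{\<omega> \<in> space M. hist 0 \<omega> = h} \<in> sets M"
        using measurable_sets[OF hist_measurable, of "{h}"] by (simp add: vimage_def Int_def conj_commute)
    qed auto
    ultimately show ?thesis by simp
  qed
next
  case (Suc t)
  have msr: "{\<omega> \<in> space M. hist t \<omega> = g} \<in> sets M" for g t
    using measurable_sets[OF hist_measurable, of "{g}"] by (simp add: vimage_def Int_def conj_commute)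
  show ?case
  proof (cases "\<exists>g y. length g = Suc t \<and> h = g @ [y]")
    case True
    then obtain g y where g: "length g = Suc t" and h: "h = g @ [y]" by blast
    have last: "last g = g ! t" using g by (cases g rule: rev_cases) (auto simp: nth_append)
    let ?A = "{\<omega> \<in> space M. hist t \<omega> = g}"
    let ?B = "{\<omega> \<in> space M. hist (Suc t) \<omega> = h}"
    have A: "?A = {\<omega> \<in> space M. \<forall>i\<le>t. (N i \<omega>, S i \<omega>) = g ! i}" using hist_eq_iff[OF g] by auto
    have B: "?B = {\<omega> \<in> space M. (N (t+1) \<omega>, S (t+1) \<omega>) = y \<and> (\<forall>i\<le>t. (N i \<omega>, S i \<omega>) = g ! i)}"
      using hist_eq_iff[OF g] by (auto simp: hist_Suc h)
    have PA: "measure M ?A = pmf (hist_law n \<mu> t) g"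
      using Suc.IH[of g] by (simp add: emeasure_eq_measure)
    have "measure M ?B = pmf (hist_law n \<mu> t) g * pmf (step n \<mu> (last g)) y"
    proof (cases "measure M ?A > 0")
      case True
      have "measure M ?B / measure M ?A = pmf (step n \<mu> (g ! t)) y"
        using transition[of t "\<lambda>i. g ! i" y] True unfolding cond_prob_def A B by simp
      then show ?thesis using True PA last by (simp add: field_simps)
    next
      \<comment> \<open>\<open>transition\<close> says nothing on a null history; both sides vanish
        there.\<close>
      case False
      then have z: "measure M ?A = 0" using measure_nonneg[of M ?A] by linarith
      have "measure M ?B \<le> measure M ?A"
        by (intro finite_measure_mono msr) (auto simp: hist_Suc h)
      then show ?thesis using z PA measure_nonneg[of M ?B] by (simp del: measure_nonneg)
    qed
    moreover have "pmf (hist_law n \<mu> (Suc t)) h = pmf (hist_law n \<mu> t) g * pmf (step n \<mu> (last g)) y"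
    proof -
      have "ennreal (pmf (hist_law n \<mu> (Suc t)) h) = (\<integral>\<^sup>+ g'. pmf (map_pmf (\<lambda>y. g' @ [y]) (step n \<mu> (last g'))) h \<partial>hist_law n \<mu> t)"
        by (simp add: ennreal_pmf_bind)
      also have "\<dots> = (\<integral>\<^sup>+ g'. pmf (step n \<mu> (last g)) y * indicator {g} g' \<partial>hist_law n \<mu> t)"
      proof (intro nn_integral_cong)
        fix g'
        show "ennreal (pmf (map_pmf (\<lambda>y. g' @ [y]) (step n \<mu> (last g'))) h) = pmf (step n \<mu> (last g)) y * indicator {g} g'"
        proof (cases "g' = g")
          case True
          have "pmf (map_pmf (\<lambda>y. g @ [y]) (step n \<mu> (last g))) (g @ [y]) = pmf (step n \<mu> (last g)) y"
            by (rule pmf_map_inj') (auto simp: inj_def)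
          then show ?thesis using True h by simp
        next
          case False
          then have "pmf (map_pmf (\<lambda>y. g' @ [y]) (step n \<mu> (last g'))) h = 0"
            using h by (auto simp: pmf_eq_0_set_pmf)
          then show ?thesis using False by simp
        qed
      qed
      also have "\<dots> = ennreal (pmf (step n \<mu> (last g)) y) * ennreal (pmf (hist_law n \<mu> t) g)"
        by (simp add: nn_integral_cmult emeasure_pmf_single)
      finally show ?thesis by (simp add: ennreal_mult[symmetric] mult.commute)
    qed
    ultimately show ?thesis by (simp add: emeasure_eq_measure)
  next
    case False
    then have "h \<notin> set_pmf (hist_law n \<mu> (Suc t))" using length_hist_law by fastforce
    then have "pmf (hist_law n \<mu> (Suc t)) h = 0" by (simp add: pmf_eq_0_set_pmf del: hist_law.simps)
    moreover have "{\<omega> \<in> space M. hist (Suc t) \<omega> = h} = {}"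
      using False length_hist[of t] unfolding hist_Suc by blast
    ultimately show ?thesis by (simp only: emeasure_empty ennreal_0)
  qed
qed

lemma distr_hist: "distr M (count_space UNIV) (hist t) = measure_pmf (hist_law n \<mu> t)"
proof (rule measure_eqI_countable[where A = UNIV])
  fix h
  have "emeasure (distr M (count_space UNIV) (hist t)) {h} = emeasure M {\<omega> \<in> space M. hist t \<omega> = h}"
    by (subst emeasure_distr[OF hist_measurable]) (auto intro!: arg_cong[where f="emeasure M"])
  then show "emeasure (distr M (count_space UNIV) (hist t)) {h} = emeasure (measure_pmf (hist_law n \<mu> t)) {h}"
    by (simp add: emeasure_hist emeasure_pmf_single)
qed auto

text \<open>One null event serves all times, so that what follows can argue path by path.\<close>

lemma AE_step: "AE \<omega> in M. \<forall>t. (N (Suc t) \<omega>, S (Suc t) \<omega>) \<in> set_pmf (step n \<mu> (N t \<omega>, S t \<omega>))"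
proof (subst AE_all_countable, intro allI)
  fix t
  have "AE h in measure_pmf (hist_law n \<mu> (Suc t)). h ! Suc t \<in> set_pmf (step n \<mu> (h ! t))"
    using hist_law_steps[of _ n \<mu> "Suc t" t] by (simp add: AE_measure_pmf_iff)
  then have "AE h in distr M (count_space UNIV) (hist (Suc t)). h ! Suc t \<in> set_pmf (step n \<mu> (h ! t))"
    by (simp only: distr_hist)
  then have "AE \<omega> in M. hist (Suc t) \<omega> ! Suc t \<in> set_pmf (step n \<mu> (hist (Suc t) \<omega> ! t))"
    by (subst (asm) AE_distr_iff[OF hist_measurable]) auto
  then show "AE \<omega> in M. (N (Suc t) \<omega>, S (Suc t) \<omega>) \<in> set_pmf (step n \<mu> (N t \<omega>, S t \<omega>))"
    unfolding hist_def by (simp add: nth_append del: upt_Suc)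
qed

end

text \<open>Probability that the chain started at \<open>x\<close> has \<open>N = n\<close> after
  \<open>t\<close> steps, decomposed at the first step. This backward form allows induction over
  starting states.\<close>

primrec full_prob :: "nat \<Rightarrow> nat pmf \<Rightarrow> nat \<Rightarrow> nat \<times> nat \<Rightarrow> ennreal" where
  "full_prob n \<mu> 0 x = (if fst x = n then 1 else 0)"
| "full_prob n \<mu> (Suc t) x = (\<integral>\<^sup>+ y. full_prob n \<mu> t y \<partial>measure_pmf (step n \<mu> x))"

text \<open>Each step of the forward history is traded for one step of the backward recursion;
  \<open>t + r\<close> is preserved.\<close>

lemma hist_law_full_prob:
  "(\<integral>\<^sup>+ h. full_prob n \<mu> r (last h) \<partial>measure_pmf (hist_law n \<mu> t)) =
   (\<integral>\<^sup>+ k. full_prob n \<mu> (t + r) (1, k) \<partial>measure_pmf \<mu>)"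
proof (induction t arbitrary: r)
  case (Suc t)
  show ?case using Suc.IH[of "Suc r"] by simp
qed simp

context server_chain
begin

lemma emeasure_N_eq:
  "emeasure M {\<omega> \<in> space M. N t \<omega> = n} = (\<integral>\<^sup>+ k. full_prob n \<mu> t (1, k) \<partial>measure_pmf \<mu>)"
proof -
  have lh: "last (hist t \<omega>) = (N t \<omega>, S t \<omega>)" for \<omega> by (simp add: hist_def)
  have "emeasure M {\<omega> \<in> space M. N t \<omega> = n} = emeasure (distr M (count_space UNIV) (hist t)) {h. fst (last h) = n}"
    by (subst emeasure_distr[OF hist_measurable]) (auto simp: lh intro!: arg_cong[where f="emeasure M"])
  also have "\<dots> = (\<integral>\<^sup>+ h. indicator {h. fst (last h) = n} h \<partial>measure_pmf (hist_law n \<mu> t))"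
    by (simp add: distr_hist)
  also have "\<dots> = (\<integral>\<^sup>+ h. full_prob n \<mu> 0 (last h) \<partial>measure_pmf (hist_law n \<mu> t))"
    by (intro nn_integral_cong) (auto simp: indicator_def)
  finally show ?thesis by (simp only: hist_law_full_prob add_0_right)
qed

text \<open>Almost surely \<open>N\<close> is frozen once \<open>S = 0\<close>, and once \<open>N = n\<close> the stock \<open>S\<close> decreases to \<open>0\<close>.
  So up to a null event \<open>Trans\<close> is the increasing union of the events \<open>N t = n\<close>.\<close>

lemma path_absorbed:
  assumes st: "\<forall>t. (N (Suc t) \<omega>, S (Suc t) \<omega>) \<in> set_pmf (step n \<mu> (N t \<omega>, S t \<omega>))" and "S t \<omega> = 0"
  shows "N (t + r) \<omega> = N t \<omega> \<and> S (t + r) \<omega> = 0"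
proof (induction r)
  case (Suc r)
  then show ?case using st[rule_format, of "t + r"] assms by (simp add: step_def)
qed (use assms in simp)

lemma path_full:
  assumes st: "\<forall>t. (N (Suc t) \<omega>, S (Suc t) \<omega>) \<in> set_pmf (step n \<mu> (N t \<omega>, S t \<omega>))"
    and "N t \<omega> = n" and "n \<ge> 1"
  shows "N (t + r) \<omega> = n \<and> S (t + r) \<omega> = S t \<omega> - r"
proof (induction r)
  case (Suc r)
  then show ?case using st[rule_format, of "t + r"] assms
    by (simp add: step_full)
qed (use assms in simp)

lemma Trans_iff:
  assumes st: "\<forall>t. (N (Suc t) \<omega>, S (Suc t) \<omega>) \<in> set_pmf (step n \<mu> (N t \<omega>, S t \<omega>))"
    and "n \<ge> 1" and "\<omega> \<in> space M"
  shows "\<omega> \<in> Trans M n N S \<longleftrightarrow> (\<exists>t. N t \<omega> = n)"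
proof
  assume "\<exists>t. N t \<omega> = n"
  then obtain t where t: "N t \<omega> = n" by blast
  have ex: "S (t + S t \<omega>) \<omega> = 0" using path_full[OF st t assms(2), of "S t \<omega>"] by simp
  define \<tau> where "\<tau> = (LEAST t. S t \<omega> = 0)"
  have S\<tau>: "S \<tau> \<omega> = 0" unfolding \<tau>_def using ex by (rule LeastI)
  have "N \<tau> \<omega> = n"
  proof (cases "\<tau> \<le> t")
    case True
    then show ?thesis using path_absorbed[OF st S\<tau>, of "t - \<tau>"] t by simp
  next
    case False
    then show ?thesis using path_full[OF st t assms(2), of "\<tau> - t"] by simp
  qed
  then show "\<omega> \<in> Trans M n N S" using ex assms unfolding Trans_def \<tau>_def by auto
qed (auto simp: Trans_def)

lemma emeasure_Trans_Sup:
  assumes n: "n \<ge> 1"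
  shows "emeasure M (Trans M n N S) = (SUP t. \<integral>\<^sup>+ k. full_prob n \<mu> t (1, k) \<partial>measure_pmf \<mu>)"
proof -
  let ?A = "\<lambda>t. {\<omega> \<in> space M. \<exists>i\<le>t. N i \<omega> = n}"
  have A: "?A t \<in> sets M" for t
  proof -
    have "?A t = (\<Union>i\<in>{..t}. {\<omega> \<in> space M. N i \<omega> = n})" by auto
    then show ?thesis by auto
  qed
  \<comment> \<open>Measurability of \<open>Trans\<close>: split by the value of the hitting
    time.\<close>
  have "Trans M n N S = (\<Union>t. {\<omega> \<in> space M. S t \<omega> = 0 \<and> N t \<omega> = n \<and> (\<forall>i<t. S i \<omega> \<noteq> 0)})" (is "_ = ?T")
  proof (intro set_eqI iffI)
    fix \<omega> assume "\<omega> \<in> Trans M n N S"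
    then have "\<omega> \<in> space M" "\<exists>t. S t \<omega> = 0" "N (LEAST t. S t \<omega> = 0) \<omega> = n"
      unfolding Trans_def by auto
    moreover from this have "S (LEAST t. S t \<omega> = 0) \<omega> = 0" by (auto intro: LeastI)
    moreover have "\<forall>i<(LEAST t. S t \<omega> = 0). S i \<omega> \<noteq> 0" by (auto dest: not_less_Least)
    ultimately show "\<omega> \<in> ?T" by blast
  next
    fix \<omega> assume "\<omega> \<in> ?T"
    then obtain t where t: "\<omega> \<in> space M" "S t \<omega> = 0" "N t \<omega> = n" "\<forall>i<t. S i \<omega> \<noteq> 0" by auto
    have "(LEAST t. S t \<omega> = 0) = t" using t by (intro Least_equality) (auto simp: not_less[symmetric])
    then have "N (LEAST t. S t \<omega> = 0) \<omega> = n" using t by (simp only:)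
    then show "\<omega> \<in> Trans M n N S" using t(1,2) unfolding Trans_def by blast
  qed
  moreover have "{\<omega> \<in> space M. S t \<omega> = 0 \<and> N t \<omega> = n \<and> (\<forall>i<t. S i \<omega> \<noteq> 0)} \<in> sets M" for t
  proof -
    have "{\<omega> \<in> space M. S t \<omega> = 0 \<and> N t \<omega> = n \<and> (\<forall>i<t. S i \<omega> \<noteq> 0)} =
      {\<omega> \<in> space M. S t \<omega> = 0} \<inter> {\<omega> \<in> space M. N t \<omega> = n} - (\<Union>i\<in>{..<t}. {\<omega> \<in> space M. S i \<omega> = 0})" by auto
    then show ?thesis by auto
  qed
  ultimately have T: "Trans M n N S \<in> sets M" by auto
  have "emeasure M (Trans M n N S) = emeasure M (\<Union>t. ?A t)"
  proof (rule emeasure_eq_AE[OF _ T])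
    show "AE \<omega> in M. (\<omega> \<in> Trans M n N S) = (\<omega> \<in> (\<Union>t. ?A t))"
      using AE_step AE_space by eventually_elim (use Trans_iff[OF _ n] in auto)
  qed (use A in auto)
  also have "\<dots> = (SUP t. emeasure M (?A t))"
    by (rule SUP_emeasure_incseq[symmetric]) (use A in \<open>auto simp: incseq_def intro: le_trans\<close>)
  \<comment> \<open>Up to a null event, \<open>N\<close> stays at \<open>n\<close> once there, so
    the union up to time \<open>t\<close> is the event at time \<open>t\<close>.\<close>
  also have "\<dots> = (SUP t. emeasure M {\<omega> \<in> space M. N t \<omega> = n})"
  proof (intro SUP_cong refl emeasure_eq_AE[OF _ A])
    fix t
    show "AE \<omega> in M. (\<omega> \<in> ?A t) = (\<omega> \<in> {\<omega> \<in> space M. N t \<omega> = n})"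
      using AE_step AE_space
    proof eventually_elim
      case (elim \<omega>)
      have "N t \<omega> = n" if "i \<le> t" "N i \<omega> = n" for i
        using path_full[OF elim(1) that(2) n, of "t - i"] that by simp
      then show ?case using elim by auto
    qed
  qed auto
  finally show ?thesis by (simp add: emeasure_N_eq)
qed

end

subsection \<open>Comparison with the coupon collector\<close>

text \<open>Probability that \<open>m\<close> uniform draws among \<open>n\<close> servers complete
  a collection of \<open>N\<close> known ones, with no stock constraint. At \<open>N = n\<close> the
  weight of \<open>coupon n m (Suc N)\<close> is \<open>0\<close>, so values beyond \<open>n\<close>
  do not matter.\<close>

primrec coupon :: "nat \<Rightarrow> nat \<Rightarrow> nat \<Rightarrow> real" where
  "coupon n 0 N = (if n \<le> N then 1 else 0)"
| "coupon n (Suc m) N = real N / real n * coupon n m N + (1 - real N / real n) * coupon n m (Suc N)"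

lemma coupon_full: "n \<ge> 1 \<Longrightarrow> coupon n m n = 1"
  by (induction m) auto

lemma coupon_bounds: "N \<le> n \<Longrightarrow> n \<ge> 1 \<Longrightarrow> 0 \<le> coupon n m N \<and> coupon n m N \<le> 1"
proof (induction m arbitrary: N)
  case (Suc m)
  show ?case
  proof (cases "N = n")
    case True
    then show ?thesis using coupon_full[of n "Suc m"] Suc.prems by (simp del: coupon.simps)
  next
    case False
    then have p: "0 \<le> real N / real n" "real N / real n \<le> 1" using Suc.prems by auto
    have a: "0 \<le> coupon n m N \<and> coupon n m N \<le> 1" "0 \<le> coupon n m (Suc N) \<and> coupon n m (Suc N) \<le> 1"
      using Suc.IH[of N] Suc.IH[of "Suc N"] Suc.prems False by auto
    then show ?thesis using p
      convex_bound_le[of "coupon n m N" 1 "coupon n m (Suc N)" "real N / real n" "1 - real N / real n"] by simp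
  qed
qed auto

lemma nn_integral_step:
  assumes "N \<le> n" "n \<ge> 1" "s > 0"
  shows "(\<integral>\<^sup>+ y. f y \<partial>measure_pmf (step n \<mu> (N, s))) =
    ennreal (real N / real n) * f (N, s - 1)
    + ennreal (1 - real N / real n) * (\<integral>\<^sup>+ k. f (Suc N, s + k - 1) \<partial>measure_pmf \<mu>)"
  using assms by (simp add: step_def mult.commute add.commute)

text \<open>A relaxation of the chain: the contributions of the servers still to come are credited
  at once, so only their total limits the draws. There are \<open>n - 1 - N\<close> of them, because
  that of the last server comes too late to help.\<close>

definition comparison :: "nat \<Rightarrow> nat pmf \<Rightarrow> nat \<Rightarrow> nat \<Rightarrow> ennreal" where
  "comparison n \<mu> N s = (\<integral>\<^sup>+ ks. ennreal (coupon n (s + sum_list ks) N) \<partial>replicate_pmf (n - 1 - N) \<mu>)"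

lemma comparison_full: "n \<ge> 1 \<Longrightarrow> comparison n \<mu> n s = 1"
  by (simp add: comparison_def coupon_full)

text \<open>This is the first-step equation of \<open>full_prob\<close>: any draw spends one unit of
  the credited total, and a new server merely moves one contribution from \<open>ks\<close> to the
  stock.\<close>

lemma comparison_step:
  assumes "N < n" "s > 0"
  shows "comparison n \<mu> N s = ennreal (real N / real n) * comparison n \<mu> N (s - 1)
    + ennreal (1 - real N / real n) * (\<integral>\<^sup>+ k. comparison n \<mu> (Suc N) (s + k - 1) \<partial>measure_pmf \<mu>)"
proof -
  obtain s' where s: "s = Suc s'" using assms(2) by (cases s) auto
  define p where "p = real N / real n"
  have p: "0 \<le> p" "p \<le> 1" using assms by (auto simp: p_def)
  have c: "ennreal (coupon n (Suc m) N) = ennreal p * ennreal (coupon n m N) + ennreal (1 - p) * ennreal (coupon n m (Suc N))" for m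
    using p coupon_bounds[of N n m] coupon_bounds[of "Suc N" n m] assms(1)
    by (simp add: p_def[symmetric] ennreal_mult[symmetric])
  show ?thesis
  proof (cases "Suc N = n")
    \<comment> \<open>With \<open>N = n - 1\<close> no contribution remains in \<open>ks\<close>,
      and the claim reduces to the recursion for \<open>coupon\<close>.\<close>
    case True
    then show ?thesis using assms comparison_full[of n]
      by (simp add: comparison_def s c p_def del: coupon.simps)
  next
    case False
    then have r: "n - 1 - N = Suc (n - 1 - Suc N)" using assms by auto
    have "comparison n \<mu> N s = (\<integral>\<^sup>+ k. \<integral>\<^sup>+ ks. ennreal (coupon n (Suc (s' + k + sum_list ks)) N)
        \<partial>replicate_pmf (n - 1 - Suc N) \<mu> \<partial>\<mu>)"
      unfolding comparison_def r s by (simp add: ac_simps del: coupon.simps)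
    also have "\<dots> = ennreal p * (\<integral>\<^sup>+ k. \<integral>\<^sup>+ ks. ennreal (coupon n (s' + k + sum_list ks) N) \<partial>replicate_pmf (n - 1 - Suc N) \<mu> \<partial>\<mu>)
       + ennreal (1 - p) * (\<integral>\<^sup>+ k. \<integral>\<^sup>+ ks. ennreal (coupon n (s' + k + sum_list ks) (Suc N)) \<partial>replicate_pmf (n - 1 - Suc N) \<mu> \<partial>\<mu>)"
      by (simp add: c nn_integral_add nn_integral_cmult del: coupon.simps)
    also have "\<dots> = ennreal p * comparison n \<mu> N (s - 1)
       + ennreal (1 - p) * (\<integral>\<^sup>+ k. comparison n \<mu> (Suc N) (s + k - 1) \<partial>measure_pmf \<mu>)"
      unfolding comparison_def r s by (simp add: ac_simps del: coupon.simps)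
    finally show ?thesis by (simp add: p_def)
  qed
qed

text \<open>Both sides obey the same recursion while \<open>s > 0\<close>; the loss comes from
  \<open>s = 0\<close>, where the chain is stuck, and from the finite horizon
  \<open>t\<close>.\<close>

lemma full_prob_le_comparison:
  assumes "n \<ge> 1"
  shows "N \<le> n \<Longrightarrow> full_prob n \<mu> t (N, s) \<le> comparison n \<mu> N s"
proof (induction t arbitrary: N s)
  case 0
  then show ?case using comparison_full[OF assms] by simp
next
  case (Suc t)
  show ?case
  proof (cases "N = n")
    case True
    then show ?thesis using Suc.IH[of n "s - 1"] by (simp add: step_full[OF assms] comparison_full[OF assms])
  next
    case False
    show ?thesis
    proof (cases "s = 0")
      case True
      then show ?thesis using Suc by (simp add: step_def)
    next
      case s: False
      then show ?thesis using False Suc assms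
        by (auto simp: nn_integral_step comparison_step intro!: add_mono mult_left_mono nn_integral_mono)
    qed
  qed
qed

lemma full_prob_full: "n \<ge> 1 \<Longrightarrow> full_prob n \<mu> t (n, s) = 1"
  by (induction t arbitrary: s) (auto simp: step_full)

lemma nn_integral_pmf_swap:
  "(\<integral>\<^sup>+ x. \<integral>\<^sup>+ y. f x y \<partial>measure_pmf B \<partial>measure_pmf A) = (\<integral>\<^sup>+ y. \<integral>\<^sup>+ x. f x y \<partial>measure_pmf A \<partial>measure_pmf B)"
proof -
  have "(\<integral>\<^sup>+ x. \<integral>\<^sup>+ y. f x y \<partial>measure_pmf B \<partial>measure_pmf A) = (\<integral>\<^sup>+ z. f (fst z) (snd z) \<partial>pair_pmf A B)"
    by (simp add: nn_integral_pair_pmf')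
  also have "\<dots> = (\<integral>\<^sup>+ z. f (snd z) (fst z) \<partial>pair_pmf B A)"
    by (subst pair_commute_pmf) (simp add: case_prod_unfold)
  finally show ?thesis by (simp add: nn_integral_pair_pmf')
qed

section \<open>Driving the chain by words of draws\<close>

definition word_pmf :: "nat \<Rightarrow> nat \<Rightarrow> nat list pmf" where
  "word_pmf n m = replicate_pmf m (pmf_of_set {..<n})"

text \<open>A state \<open>(N, s)\<close> is represented by a set \<open>A\<close> of \<open>N\<close> known servers; the word \<open>w\<close> lists the
  servers drawn next and \<open>ks\<close> the contributions of the servers reached.\<close>

definition sustained :: "nat \<Rightarrow> nat set \<Rightarrow> nat \<Rightarrow> nat list \<Rightarrow> nat list \<Rightarrow> bool" where
  "sustained n A s w ks \<longleftrightarrow> A \<union> set w = {..<n} \<and>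
     (\<forall>t<length w. A \<union> set (take t w) \<noteq> {..<n} \<longrightarrow> t < s + sum_list (take (card (set (take t w) - A)) ks))"

lemma sustained_pos: "sustained n A s w ks \<Longrightarrow> A \<noteq> {..<n} \<Longrightarrow> s > 0"
proof (rule ccontr)
  assume a: "sustained n A s w ks" "A \<noteq> {..<n}" "\<not> s > 0"
  then have "w \<noteq> []" unfolding sustained_def by (metis list.set(1) sup_bot_right)
  then have "0 < s + sum_list (take (card (set (take 0 w) - A)) ks)"
    using a unfolding sustained_def by (metis length_greater_0_conv list.set(1) sup_bot_right take0)
  then show False using a by simp
qed

text \<open>A draw spends one unit: the constraint at \<open>Suc t\<close> for \<open>x # w\<close>
  is the constraint at \<open>t\<close> for \<open>w\<close> with stock
  \<open>s - 1\<close>.\<close>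

lemma sustained_known:
  assumes "sustained n A s (x # w) ks" "x \<in> A" "s > 0"
  shows "sustained n A (s - 1) w ks"
  unfolding sustained_def
proof (intro conjI allI impI)
  have "A \<union> set (x # w) = {..<n}" using assms(1) unfolding sustained_def by blast
  then show "A \<union> set w = {..<n}" using assms(2) by (simp add: insert_absorb)
  fix t assume t: "t < length w" "A \<union> set (take t w) \<noteq> {..<n}"
  have "set (take (Suc t) (x # w)) - A = set (take t w) - A" "A \<union> set (take (Suc t) (x # w)) = A \<union> set (take t w)"
    using assms(2) by auto
  then have "Suc t < s + sum_list (take (card (set (take t w) - A)) ks)"
    using assms(1) t unfolding sustained_def by (metis Suc_less_eq length_Cons)
  then show "t < s - 1 + sum_list (take (card (set (take t w) - A)) ks)" using assms(3) by simp
qed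

text \<open>The same shift, with the new server releasing the first entry of \<open>ks\<close>; the
  two counts of new servers differ by one.\<close>

lemma sustained_new:
  assumes "sustained n A s (x # w) (k # ks)" "x \<notin> A" "s > 0"
  shows "sustained n (insert x A) (s + k - 1) w ks"
  unfolding sustained_def
proof (intro conjI allI impI)
  have "A \<union> set (x # w) = {..<n}" using assms(1) unfolding sustained_def by blast
  then show "insert x A \<union> set w = {..<n}" by simp
  fix t assume t: "t < length w" "insert x A \<union> set (take t w) \<noteq> {..<n}"
  have e: "set (take (Suc t) (x # w)) - A = insert x (set (take t w) - insert x A)" 
    "A \<union> set (take (Suc t) (x # w)) = insert x A \<union> set (take t w)"
    using assms(2) by auto
  have "card (set (take (Suc t) (x # w)) - A) = Suc (card (set (take t w) - insert x A))"
    unfolding e by (subst card_insert_disjoint) auto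
  then have "Suc t < s + sum_list (take (Suc (card (set (take t w) - insert x A))) (k # ks))"
    using assms(1) t e(2) unfolding sustained_def by (metis Suc_less_eq length_Cons)
  then show "t < s + k - 1 + sum_list (take (card (set (take t w) - insert x A)) ks)" using assms(3) by simp
qed

lemma nn_integral_uniform_split:
  fixes a b :: ennreal
  assumes "A \<subseteq> {..<n}" "n \<ge> 1"
  shows "(\<integral>\<^sup>+ x. (if x \<in> A then a else b) \<partial>pmf_of_set {..<n}) =
    ennreal (real (card A) / real n) * a + ennreal (1 - real (card A) / real n) * b"
proof -
  have ne: "{..<n} \<noteq> {}" using assms by (simp add: lessThan_empty_iff)
  have c: "card A \<le> n" using card_mono[OF _ assms(1)] by simp
  have "(\<integral>\<^sup>+ x. (if x \<in> A then a else b) \<partial>pmf_of_set {..<n}) = (\<integral>\<^sup>+ x. a * indicator A x + b * indicator (- A) x \<partial>pmf_of_set {..<n})"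
    by (intro nn_integral_cong) (auto simp: indicator_def)
  also have "\<dots> = a * emeasure (pmf_of_set {..<n}) A + b * emeasure (pmf_of_set {..<n}) (- A)"
    by (simp add: nn_integral_add nn_integral_cmult)
  also have "emeasure (pmf_of_set {..<n}) A = ennreal (real (card A) / real n)"
    using ne assms by (simp add: emeasure_pmf_of_set Int_absorb1)
  also have "emeasure (pmf_of_set {..<n}) (- A) = ennreal (1 - real (card A) / real n)"
  proof -
    have "card ({..<n} \<inter> - A) = n - card A"
      using assms by (simp add: Diff_eq[symmetric] card_Diff_subset finite_subset[OF assms(1)])
    then show ?thesis using ne assms c by (simp add: emeasure_pmf_of_set of_nat_diff diff_divide_distrib)
  qed
  finally show ?thesis by (simp add: mult.commute)
qed

text \<open>The chain can be driven by independent letters and contributions. When the first letter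
  is new, the next entry of \<open>ks\<close> is exposed; it is independent of the remaining
  letters, so the integrals can be exchanged before the induction hypothesis is applied.\<close>

lemma sustained_le_full_prob:
  assumes n: "n \<ge> 1"
  shows "A \<subseteq> {..<n} \<Longrightarrow> (\<integral>\<^sup>+ w. \<integral>\<^sup>+ ks. (if sustained n A s w ks then 1 else 0)
      \<partial>replicate_pmf (n - 1 - card A) \<mu> \<partial>word_pmf n m) \<le> full_prob n \<mu> m (card A, s)"
proof (induction m arbitrary: A s)
  case 0
  then show ?case
    by (auto simp: word_pmf_def sustained_def measure_pmf.emeasure_space_1)
next
  case (Suc m)
  let ?W = "word_pmf n m"
  let ?R = "replicate_pmf (n - 1 - card A) \<mu>"
  have W: "word_pmf n (Suc m) = bind_pmf (pmf_of_set {..<n}) (\<lambda>x. bind_pmf ?W (\<lambda>w. return_pmf (x # w)))"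
    by (simp add: word_pmf_def)
  have fin: "finite A" using Suc.prems finite_subset by blast
  let ?I = "\<lambda>P. if P then 1 else 0 :: ennreal"
  have le1: "(\<integral>\<^sup>+ w. \<integral>\<^sup>+ ks. ?I (Q w ks) \<partial>measure_pmf R \<partial>measure_pmf V) \<le> 1" for Q and R :: "'z pmf" and V :: "'y pmf"
  proof -
    have "(\<integral>\<^sup>+ w. \<integral>\<^sup>+ ks. ?I (Q w ks) \<partial>measure_pmf R \<partial>measure_pmf V) \<le> (\<integral>\<^sup>+ w. \<integral>\<^sup>+ ks. 1 \<partial>measure_pmf R \<partial>measure_pmf V)"
      by (intro nn_integral_mono) auto
    then show ?thesis by simp
  qed
  show ?case
  proof (cases "A = {..<n}")
    case True
    then have "full_prob n \<mu> (Suc m) (card A, s) = 1" using full_prob_full[OF n, of \<mu> "Suc m" s] by (simp only: card_lessThan)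
    then show ?thesis by (simp only: le1)
  next
    case False
    then have cA: "card A < n" using Suc.prems psubset_card_mono[of "{..<n}" A] by auto
    show ?thesis
    proof (cases "s = 0")
      case True
      then have "\<not> sustained n A s w ks" for w ks using sustained_pos False by blast
      then show ?thesis by simp
    next
      case s: False
      let ?a = "full_prob n \<mu> m (card A, s - 1)"
      let ?b = "\<integral>\<^sup>+ k. full_prob n \<mu> m (Suc (card A), s + k - 1) \<partial>measure_pmf \<mu>"
      have "(\<integral>\<^sup>+ w. \<integral>\<^sup>+ ks. ?I (sustained n A s w ks) \<partial>?R \<partial>word_pmf n (Suc m))
        = (\<integral>\<^sup>+ x. \<integral>\<^sup>+ w. \<integral>\<^sup>+ ks. ?I (sustained n A s (x # w) ks) \<partial>?R \<partial>?W \<partial>pmf_of_set {..<n})"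
        by (simp add: W)
      also have "\<dots> \<le> (\<integral>\<^sup>+ x. (if x \<in> A then ?a else ?b) \<partial>pmf_of_set {..<n})"
      proof (intro nn_integral_mono_AE, subst AE_measure_pmf_iff, intro ballI)
        fix x assume "x \<in> set_pmf (pmf_of_set {..<n})"
        moreover have "set_pmf (pmf_of_set {..<n}) = {..<n}" using n by (intro set_pmf_of_set) (auto simp: lessThan_empty_iff)
        ultimately have x: "x < n" by auto
        show "(\<integral>\<^sup>+ w. \<integral>\<^sup>+ ks. ?I (sustained n A s (x # w) ks) \<partial>?R \<partial>?W) \<le> (if x \<in> A then ?a else ?b)"
        proof (cases "x \<in> A")
          case True
          have "(\<integral>\<^sup>+ w. \<integral>\<^sup>+ ks. ?I (sustained n A s (x # w) ks) \<partial>?R \<partial>?W) \<le>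
              (\<integral>\<^sup>+ w. \<integral>\<^sup>+ ks. ?I (sustained n A (s - 1) w ks) \<partial>?R \<partial>?W)"
            using sustained_known[OF _ True] s by (intro nn_integral_mono) auto
          then show ?thesis using Suc.IH[OF Suc.prems, of "s - 1"] True by simp
        next
          case xA: False
          have c: "card (insert x A) = Suc (card A)" using xA fin by simp
          show ?thesis
          proof (cases "Suc (card A) = n")
            \<comment> \<open>\<open>ks\<close> is exhausted, but the collection is complete and the
              right-hand side is \<open>1\<close>.\<close>
            case True
            then have "?b = 1" using full_prob_full[OF n] by simp
            then show ?thesis using le1 xA by simp
          next
            case False
            then have r: "n - 1 - card A = Suc (n - 1 - card (insert x A))" using cA c by simp
            let ?R' = "replicate_pmf (n - 1 - card (insert x A)) \<mu>"
            have "(\<integral>\<^sup>+ w. \<integral>\<^sup>+ ks. ?I (sustained n A s (x # w) ks) \<partial>?R \<partial>?W) =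
              (\<integral>\<^sup>+ w. \<integral>\<^sup>+ k. \<integral>\<^sup>+ ks. ?I (sustained n A s (x # w) (k # ks)) \<partial>?R' \<partial>\<mu> \<partial>?W)"
              unfolding r by simp
            also have "\<dots> \<le> (\<integral>\<^sup>+ w. \<integral>\<^sup>+ k. \<integral>\<^sup>+ ks. ?I (sustained n (insert x A) (s + k - 1) w ks) \<partial>?R' \<partial>\<mu> \<partial>?W)"
              using sustained_new[OF _ xA] s by (intro nn_integral_mono) auto
            also have "\<dots> = (\<integral>\<^sup>+ k. \<integral>\<^sup>+ w. \<integral>\<^sup>+ ks. ?I (sustained n (insert x A) (s + k - 1) w ks) \<partial>?R' \<partial>?W \<partial>\<mu>)"
              by (rule nn_integral_pmf_swap)
            also have "\<dots> \<le> (\<integral>\<^sup>+ k. full_prob n \<mu> m (card (insert x A), s + k - 1) \<partial>\<mu>)"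
              using Suc.prems x by (intro nn_integral_mono Suc.IH) auto
            finally show ?thesis using xA c by simp
          qed
        qed
      qed
      also have "\<dots> = full_prob n \<mu> (Suc m) (card A, s)"
        using nn_integral_uniform_split[OF Suc.prems n, of ?a ?b] nn_integral_step[of "card A" n s \<mu>] cA s n
        by simp
      finally show ?thesis .
    qed
  qed
qed

text \<open>Turns the recursion into an event on words, on which rotations act.\<close>

lemma coupon_word:
  assumes n: "n \<ge> 1"
  shows "A \<subseteq> {..<n} \<Longrightarrow> emeasure (word_pmf n m) {w. {..<n} \<subseteq> A \<union> set w} = ennreal (coupon n m (card A))"
proof (induction m arbitrary: A)
  case 0
  have "n \<le> card A \<longleftrightarrow> {..<n} \<subseteq> A"
  proof
    assume "n \<le> card A"
    then have "A = {..<n}" by (intro card_seteq 0) simp_all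
    then show "{..<n} \<subseteq> A" by (simp only: order_refl)
  next
    assume "{..<n} \<subseteq> A"
    from card_mono[OF finite_subset[OF 0 finite_lessThan] this] show "n \<le> card A" by simp
  qed
  then show ?case by (simp add: word_pmf_def indicator_def)
next
  case (Suc m)
  have fin: "finite A" using Suc.prems finite_subset by blast
  have c: "card A \<le> n" using card_mono[OF _ Suc.prems] by simp
  have W: "word_pmf n (Suc m) = bind_pmf (pmf_of_set {..<n}) (\<lambda>x. map_pmf ((#) x) (word_pmf n m))"
    by (simp add: word_pmf_def map_pmf_def)
  have "emeasure (word_pmf n (Suc m)) {w. {..<n} \<subseteq> A \<union> set w} =
     (\<integral>\<^sup>+ x. emeasure (word_pmf n m) {w. {..<n} \<subseteq> insert x A \<union> set w} \<partial>pmf_of_set {..<n})"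
    by (simp add: W emeasure_bind_pmf vimage_def)
  also have "\<dots> = (\<integral>\<^sup>+ x. (if x \<in> A then ennreal (coupon n m (card A)) else ennreal (coupon n m (Suc (card A)))) \<partial>pmf_of_set {..<n})"
  proof (intro nn_integral_cong_AE, subst AE_measure_pmf_iff, intro ballI)
    fix x assume "x \<in> set_pmf (pmf_of_set {..<n})"
    moreover have "set_pmf (pmf_of_set {..<n}) = {..<n}" using n by (intro set_pmf_of_set) (auto simp: lessThan_empty_iff)
    ultimately have x: "insert x A \<subseteq> {..<n}" using Suc.prems by auto
    then show "emeasure (word_pmf n m) {w. {..<n} \<subseteq> insert x A \<union> set w} =
      (if x \<in> A then ennreal (coupon n m (card A)) else ennreal (coupon n m (Suc (card A))))"
      using Suc.IH[OF x] fin by (simp add: insert_absorb)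
  qed
  also have "\<dots> = ennreal (coupon n (Suc m) (card A))"
  proof (cases "card A = n")
    case True
    have 1: "coupon n m n = 1" "coupon n (Suc m) n = 1" "real n / real n = 1"
      using coupon_full[OF n, of m] coupon_full[OF n, of "Suc m"] n by (simp_all del: coupon.simps)
    show ?thesis unfolding nn_integral_uniform_split[OF Suc.prems n] True 1 by simp
  next
    case False
    define p where "p = real (card A) / real n"
    have p: "0 \<le> p" "p \<le> 1" using c n by (auto simp: p_def)
    have 2: "0 \<le> coupon n m (card A)" "0 \<le> coupon n m (Suc (card A))"
      using coupon_bounds[of "card A" n m] coupon_bounds[of "Suc (card A)" n m] c n False by auto
    have 3: "coupon n (Suc m) (card A) = p * coupon n m (card A) + (1 - p) * coupon n m (Suc (card A))"
      by (simp add: p_def)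
    show ?thesis unfolding nn_integral_uniform_split[OF Suc.prems n] 3 p_def[symmetric]
      using p 2 by (subst ennreal_plus) (auto simp: ennreal_mult)
  qed
  finally show ?case .
qed

subsection \<open>Cycle lemmas\<close>

lemma map_rotate1_replicate_pmf: "map_pmf rotate1 (replicate_pmf m p) = replicate_pmf m p"
proof (cases m)
  case (Suc k)
  have "map_pmf rotate1 (replicate_pmf (Suc k) p) = bind_pmf p (\<lambda>x. bind_pmf (replicate_pmf k p) (\<lambda>xs. return_pmf (xs @ [x])))"
    by (simp add: map_bind_pmf)
  also have "\<dots> = bind_pmf (replicate_pmf k p) (\<lambda>xs. bind_pmf p (\<lambda>x. return_pmf (xs @ [x])))"
    by (rule bind_commute_pmf)
  also have "\<dots> = replicate_pmf (k + 1) p"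
    unfolding replicate_pmf_distrib by (simp add: bind_assoc_pmf bind_return_pmf)
  finally show ?thesis by (simp add: Suc)
qed simp

lemma map_rotate_replicate_pmf: "map_pmf (rotate r) (replicate_pmf m p) = replicate_pmf m p"
proof (induction r)
  case (Suc r)
  have "map_pmf (rotate (Suc r)) (replicate_pmf m p) = map_pmf rotate1 (map_pmf (rotate r) (replicate_pmf m p))"
    by (simp add: map_pmf_comp rotate_def o_def)
  then show ?case by (simp only: Suc map_rotate1_replicate_pmf)
qed (simp add: map_pmf_ident)

text \<open>Independent identically distributed entries have a rotation-invariant law, so a union
  bound over the \<open>m\<close> rotations costs only a factor \<open>m\<close>.\<close>

lemma prob_rotate:
  assumes "\<And>xs. xs \<in> set_pmf (replicate_pmf m p) \<Longrightarrow> xs \<in> P \<Longrightarrow> \<exists>r<m. rotate r xs \<in> G"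
  shows "measure (replicate_pmf m p) P \<le> real m * measure (replicate_pmf m p) G"
proof -
  let ?R = "replicate_pmf m p"
  have "measure ?R P = measure ?R (P \<inter> set_pmf ?R)" by (simp add: measure_Int_set_pmf)
  also have "\<dots> \<le> measure ?R (\<Union>r<m. rotate r -` G)"
    by (intro measure_pmf.finite_measure_mono) (use assms in fastforce)+
  also have "\<dots> \<le> (\<Sum>r<m. measure ?R (rotate r -` G))"
    by (intro measure_pmf.finite_measure_subadditive_finite) auto
  also have "\<dots> = (\<Sum>r<m. measure (map_pmf (rotate r) ?R) G)"
    by (simp only: measure_map_pmf)
  finally show ?thesis by (simp add: map_rotate_replicate_pmf)
qed

text \<open>Rotate to the position where the prefix sum is least.\<close>

lemma cycle_lemma:
  fixes xs :: "real list"
  assumes "sum_list xs \<ge> 0" "xs \<noteq> []"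
  shows "\<exists>r<length xs. \<forall>j\<le>length xs. 0 \<le> sum_list (take j (rotate r xs))"
proof -
  define P where "P i = sum_list (take i xs)" for i
  obtain r where r: "r < length xs" "\<And>i. i < length xs \<Longrightarrow> P r \<le> P i"
    using ex_min_if_finite[of "P ` {..<length xs}"] assms(2)
    by (auto simp: not_less lessThan_empty_iff)
  have P0: "P 0 = 0" "P (length xs) \<ge> 0" using assms by (auto simp: P_def)
  have Pr: "P r \<le> P i" if "i \<le> length xs" for i
    using that r(2)[of i] r(2)[of 0] P0 assms(2) by (cases "i = length xs") auto
  have sp: "sum_list (drop r (take i xs)) = P i - P r" if "r \<le> i" for i
  proof -
    have "take i xs = take r xs @ drop r (take i xs)"
      using append_take_drop_id[of r "take i xs"] that by (simp add: min_def)
    then have "P i = P r + sum_list (drop r (take i xs))" unfolding P_def by (metis sum_list_append)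
    then show ?thesis by simp
  qed
  have "0 \<le> sum_list (take j (rotate r xs))" if j: "j \<le> length xs" for j
  proof -
    have rot: "rotate r xs = drop r xs @ take r xs" using r by (simp add: rotate_drop_take)
    show ?thesis
    proof (cases "r + j \<le> length xs")
      case True
      then have "take j (rotate r xs) = drop r (take (r + j) xs)" by (simp add: rot drop_take)
      then show ?thesis using sp[of "r + j"] Pr[of "r + j"] True by simp
    next
      \<comment> \<open>The prefix wraps around: its sum is
        \<open>P (length xs) - P r + P (r + j - length xs)\<close>, and the total is
        nonnegative.\<close>
      case False
      then have "take j (rotate r xs) = drop r xs @ take (r + j - length xs) xs"
        using j r by (simp add: rot min_def add.commute)
      moreover have "P r \<le> P (r + j - length xs)" using j r(1) by (intro Pr) auto
      ultimately show ?thesis using sp[of "length xs"] r(1) P0 by (simp add: P_def)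
    qed
  qed
  then show ?thesis using r by blast
qed

text \<open>The cycle lemma is applied to the entries \<open>N * k - x\<close>, whose total is
  nonnegative exactly when \<open>x \<le> sum_list ks\<close>.\<close>

lemma prob_prefix_sums:
  assumes "N \<ge> 1"
  shows "measure (replicate_pmf N \<mu>) {ks. x \<le> sum_list ks}
    \<le> real N * measure (replicate_pmf N \<mu>) {ks. \<forall>j\<le>N. j * x \<le> sum_list (take j ks) * N}"
proof (rule prob_rotate)
  fix ks assume ks: "ks \<in> set_pmf (replicate_pmf N \<mu>)" "ks \<in> {ks. x \<le> sum_list ks}"
  then have len: "length ks = N" by (simp add: set_replicate_pmf)
  let ?f = "\<lambda>k. real N * real k - real x"
  have sm: "sum_list (map ?f ys) = real N * real (sum_list ys) - real x * real (length ys)" for ys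
    by (induction ys) (auto simp: algebra_simps)
  have "ks \<noteq> []" using assms len by auto
  have "sum_list (map ?f ks) \<ge> 0" 
    using ks len mult_left_mono[of "real x" "real (sum_list ks)" "real N"] by (simp only: sm) (simp add: mult.commute)
  then obtain r where r: "r < N" "\<And>j. j \<le> N \<Longrightarrow> 0 \<le> sum_list (take j (rotate r (map ?f ks)))"
    using cycle_lemma[of "map ?f ks"] \<open>ks \<noteq> []\<close> len by auto
  have "j * x \<le> sum_list (take j (rotate r ks)) * N" if "j \<le> N" for j
  proof -
    have "0 \<le> real N * real (sum_list (take j (rotate r ks))) - real x * real j"
    proof -
      have "length (take j (rotate r ks)) = j" using that len by simp
      then show ?thesis using r(2)[OF that] by (simp only: rotate_map take_map sm)
    qed
    then have "real (j * x) \<le> real (sum_list (take j (rotate r ks)) * N)" by (simp add: algebra_simps)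
    then show ?thesis by (simp only: of_nat_le_iff)
  qed
  then show "\<exists>r<N. rotate r ks \<in> {ks. \<forall>j\<le>N. j * x \<le> sum_list (take j ks) * N}" using r by blast
qed

text \<open>Marking one occurrence of each letter other than \<open>0\<close> and rotating by the cycle lemma, every
  prefix contains at least its proportional share of marks.\<close>

lemma prob_prefix_letters:
  assumes "n \<ge> 2" "m \<ge> 1"
  shows "measure (word_pmf n m) {w. {..<n} \<subseteq> insert 0 (set w)} \<le> real m * measure (word_pmf n m)
     {w. {..<n} \<subseteq> insert 0 (set w) \<and> (\<forall>t\<le>m. t * (n - 1) \<le> card (set (take t w) - {0}) * m)}"
  unfolding word_pmf_def
proof (rule prob_rotate)
  fix w assume w: "w \<in> set_pmf (replicate_pmf m (pmf_of_set {..<n}))" "w \<in> {w. {..<n} \<subseteq> insert 0 (set w)}"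
  then have len: "length w = m" by (simp add: set_replicate_pmf)
  have "\<forall>x\<in>{1..<n}. \<exists>i<m. w ! i = x" using w(2) len by (auto simp: in_set_conv_nth subset_iff)
  then obtain pos where pos: "\<And>x. x \<in> {1..<n} \<Longrightarrow> pos x < m \<and> w ! pos x = x" by metis
  have inj: "inj_on pos {1..<n}" using pos by (metis inj_onI)
  let ?P = "pos ` {1..<n}"
  have cP: "card ?P = n - 1" using inj by (simp add: card_image)
  \<comment> \<open>A mark weighs \<open>m\<close>, and \<open>n - 1\<close> is deducted at each of
    the \<open>m\<close> positions; with \<open>n - 1\<close> marks the total is
    \<open>0\<close>.\<close>
  let ?f = "\<lambda>i. (if i \<in> ?P then real m else 0) - real (n - 1)"
  have sm: "sum_list (map ?f is) = real m * real (card (?P \<inter> set is)) - real (n - 1) * real (length is)" if "distinct is" for "is"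
  proof -
    have "sum_list (map ?f is) = (\<Sum>i\<in>set is. ?f i)" using that by (simp add: sum_list_distinct_conv_sum_set)
    also have "\<dots> = (\<Sum>i\<in>set is. if i \<in> ?P then real m else 0) - real (n - 1) * real (card (set is))"
      by (simp add: sum_subtractf)
    also have "(\<Sum>i\<in>set is. if i \<in> ?P then real m else 0) = (\<Sum>i\<in>set is \<inter> ?P. real m)"
      by (rule sum.inter_restrict[symmetric]) simp
    finally show ?thesis using that by (simp add: distinct_card Int_commute)
  qed
  have "?P \<inter> {0..<m} = ?P" using pos by auto
  then have "sum_list (map ?f [0..<m]) = 0" using sm[of "[0..<m]"] cP by simp
  then obtain r where r: "r < m" "\<And>j. j \<le> m \<Longrightarrow> 0 \<le> sum_list (take j (rotate r (map ?f [0..<m])))"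
    using cycle_lemma[of "map ?f [0..<m]"] assms by auto
  have wmap: "w = map ((!) w) [0..<m]" using len by (metis map_nth)
  have "t * (n - 1) \<le> card (set (take t (rotate r w)) - {0}) * m" if t: "t \<le> m" for t
  proof -
    let ?is = "take t (rotate r [0..<m])"
    have "length ?is = t" using t by simp
    then have "0 \<le> real m * real (card (?P \<inter> set ?is)) - real (n - 1) * real t"
      using r(2)[OF t] sm[of ?is] by (simp only: rotate_map take_map) simp
    then have "real (t * (n - 1)) \<le> real (card (?P \<inter> set ?is) * m)"
      by (simp only: of_nat_mult) (simp only: algebra_simps)
    then have 1: "t * (n - 1) \<le> card (?P \<inter> set ?is) * m" by (simp only: of_nat_le_iff)
    \<comment> \<open>Marks sit on distinct letters, so the number of marks in a prefix bounds from
      below its number of distinct nonzero letters.\<close>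
    have "inj_on ((!) w) (?P \<inter> set ?is)" using pos by (intro inj_on_inverseI[where g = pos]) auto
    then have "card (?P \<inter> set ?is) = card ((!) w ` (?P \<inter> set ?is))" by (simp add: card_image)
    also have "\<dots> \<le> card (set (take t (rotate r w)) - {0})"
    proof (intro card_mono)
      have "take t (rotate r w) = map ((!) w) ?is" by (subst wmap) (simp add: rotate_map take_map)
      then show "(!) w ` (?P \<inter> set ?is) \<subseteq> set (take t (rotate r w)) - {0}" using pos by fastforce
    qed simp
    finally show ?thesis using 1 by (meson le_trans mult_le_mono1)
  qed
  then show "\<exists>r<m. rotate r w \<in> {w. {..<n} \<subseteq> insert 0 (set w) \<and> (\<forall>t\<le>m. t * (n - 1) \<le> card (set (take t w) - {0}) * m)}"
    using r w(2) by (intro exI[of _ r]) auto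
qed

text \<open>With \<open>m = length w\<close>, both conditions compare with the line of slope
  \<open>m / (n - 1)\<close>. If \<open>t\<close> draws have reached \<open>d\<close> new servers,
  the first \<open>d + 1\<close> contributions amount to at least
  \<open>(d + 1) * m / (n - 1) \<ge> t + m / (n - 1) \<ge> t + 1\<close>. The extra contribution is
  that of server \<open>0\<close>, and \<open>n - 1 \<le> m\<close> gives the strict
  inequality.\<close>

lemma sustained_if_balanced:
  assumes n: "n \<ge> 2" and x: "n - 1 \<le> length w"
    and w: "insert 0 (set w) = {..<n}" "\<forall>t\<le>length w. t * (n - 1) \<le> card (set (take t w) - {0}) * length w"
    and ks: "\<forall>j\<le>n-1. j * length w \<le> sum_list (take j (k # ks)) * (n - 1)"
  shows "sustained n {0} k w ks"
  unfolding sustained_def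
proof (intro conjI allI impI)
  show "{0} \<union> set w = {..<n}" using w by simp
  fix t assume t: "t < length w" "{0} \<union> set (take t w) \<noteq> {..<n}"
  define d where "d = card (set (take t w) - {0})"
  have sub: "insert 0 (set (take t w)) \<subseteq> {..<n}" using w(1) set_take_subset[of t w] by auto
  have "card (insert 0 (set (take t w))) < n"
    using psubset_card_mono[of "{..<n}" "insert 0 (set (take t w))"] sub t(2) by auto
  moreover have "card (insert 0 (set (take t w))) = Suc d" by (simp add: d_def card.insert_remove)
  ultimately have d: "Suc d \<le> n - 1" by simp
  have "t * (n - 1) + (n - 1) \<le> d * length w + length w"
    using w(2) t x unfolding d_def by (intro add_mono) auto
  also have "\<dots> = Suc d * length w" by simp
  also have "\<dots> \<le> sum_list (take (Suc d) (k # ks)) * (n - 1)" using ks d by blast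
  finally have "Suc t * (n - 1) \<le> (k + sum_list (take d ks)) * (n - 1)" by simp
  then have "Suc t \<le> k + sum_list (take d ks)" using n by (subst (asm) mult_le_cancel2) auto
  then show "t < k + sum_list (take (card (set (take t w) - {0})) ks)" by (simp add: d_def)
qed

context server_chain
begin

text \<open>Contributions and word are independent, so the two rotations are made separately; they
  cost the factors \<open>n - 1\<close> and \<open>x\<close>.\<close>

lemma prob_Trans_ge:
  assumes n: "n \<ge> 2" and x: "x \<ge> n - 1"
  shows "measure (replicate_pmf (n - 1) \<mu>) {ks. x \<le> sum_list ks} * coupon n x 1
     \<le> real (n - 1) * real x * measure M (Trans M n N S)"
proof -
  let ?R = "replicate_pmf (n - 1) \<mu>"
  let ?W = "word_pmf n x"
  let ?G = "{ks. \<forall>j\<le>n-1. j * x \<le> sum_list (take j ks) * (n - 1)}"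
  let ?H = "{w. {..<n} \<subseteq> insert 0 (set w) \<and> (\<forall>t\<le>x. t * (n - 1) \<le> card (set (take t w) - {0}) * x)}"
  have x1: "x \<ge> 1" using n x by simp
  have r: "n - 1 = Suc (n - 2)" using n by simp
  have setW: "length w = x \<and> set w \<subseteq> {..<n}" if "w \<in> set_pmf ?W" for w
    using that n by (auto simp: word_pmf_def set_replicate_pmf set_pmf_of_set lessThan_empty_iff)
  have "emeasure ?R ?G * emeasure ?W ?H = (\<integral>\<^sup>+ ks. \<integral>\<^sup>+ w. indicator ?G ks * indicator ?H w \<partial>?W \<partial>?R)"
    by (simp add: nn_integral_cmult nn_integral_multc)
  \<comment> \<open>The first of the \<open>n - 1\<close> contributions is the initial stock; the
    other \<open>n - 2\<close> feed \<open>sustained\<close>.\<close>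
  also have "\<dots> = (\<integral>\<^sup>+ k. \<integral>\<^sup>+ ks. \<integral>\<^sup>+ w. indicator ?G (k # ks) * indicator ?H w \<partial>?W \<partial>replicate_pmf (n - 2) \<mu> \<partial>\<mu>)"
    by (subst r) simp
  also have "\<dots> = (\<integral>\<^sup>+ k. \<integral>\<^sup>+ w. \<integral>\<^sup>+ ks. indicator ?G (k # ks) * indicator ?H w \<partial>replicate_pmf (n - 2) \<mu> \<partial>?W \<partial>\<mu>)"
    by (intro nn_integral_cong nn_integral_pmf_swap)
  also have "\<dots> \<le> (\<integral>\<^sup>+ k. \<integral>\<^sup>+ w. \<integral>\<^sup>+ ks. (if sustained n {0} k w ks then 1 else 0) \<partial>replicate_pmf (n - 2) \<mu> \<partial>?W \<partial>\<mu>)"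
  proof (rule nn_integral_mono, rule nn_integral_mono_AE, subst AE_measure_pmf_iff, intro ballI nn_integral_mono)
    fix k w ks assume "w \<in> set_pmf ?W"
    note w = setW[OF this]
    show "indicator ?G (k # ks) * indicator ?H w \<le> (if sustained n {0} k w ks then 1 else 0 :: ennreal)"
    proof (cases "k # ks \<in> ?G \<and> w \<in> ?H")
      case True
      have "sustained n {0} k w ks"
      proof (rule sustained_if_balanced[OF n])
        show "insert 0 (set w) = {..<n}" using True w n by auto
      qed (use True w x in auto)
      then show ?thesis by (simp add: indicator_def)
    qed (auto simp: indicator_def)
  qed
  also have "\<dots> \<le> (\<integral>\<^sup>+ k. full_prob n \<mu> x (1, k) \<partial>\<mu>)"
    using sustained_le_full_prob[of n "{0}"] n by (intro nn_integral_mono) (auto simp: numeral_2_eq_2)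
  also have "\<dots> \<le> emeasure M (Trans M n N S)"
    using n by (subst emeasure_Trans_Sup) (auto intro: SUP_upper)
  finally have "ennreal (measure ?R ?G * measure ?W ?H) \<le> ennreal (measure M (Trans M n N S))"
    by (simp add: measure_pmf.emeasure_eq_measure emeasure_eq_measure ennreal_mult)
  then have 1: "measure ?R ?G * measure ?W ?H \<le> measure M (Trans M n N S)" by simp
  have "coupon n x 1 = measure ?W {w. {..<n} \<subseteq> insert 0 (set w)}"
    using coupon_word[of n "{0}" x] n coupon_bounds[of 1 n x] by (auto simp: measure_pmf.emeasure_eq_measure)
  also have "\<dots> \<le> real x * measure ?W ?H" by (rule prob_prefix_letters[OF n x1])
  finally have 2: "coupon n x 1 \<le> real x * measure ?W ?H" .
  have 3: "measure ?R {ks. x \<le> sum_list ks} \<le> real (n - 1) * measure ?R ?G"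
    using n by (intro prob_prefix_sums) simp
  have "measure ?R {ks. x \<le> sum_list ks} * coupon n x 1 \<le> (real (n - 1) * measure ?R ?G) * (real x * measure ?W ?H)"
    using 2 3 coupon_bounds[of 1 n x] n by (intro mult_mono) auto
  also have "\<dots> = real (n - 1) * real x * (measure ?R ?G * measure ?W ?H)" by simp
  also have "\<dots> \<le> real (n - 1) * real x * measure M (Trans M n N S)"
    by (intro mult_left_mono 1) auto
  finally show ?thesis .
qed

lemma emeasure_Trans_le:
  assumes n: "n \<ge> 2"
  shows "emeasure M (Trans M n N S) \<le> (\<integral>\<^sup>+ ks. ennreal (coupon n (sum_list ks) 1) \<partial>replicate_pmf (n - 1) \<mu>)"
proof -
  have r: "replicate_pmf (n - 1) \<mu> = replicate_pmf (Suc (n - 1 - 1)) \<mu>" using n by (intro arg_cong[where f = "\<lambda>m. replicate_pmf m \<mu>"]) simp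
  have "(\<integral>\<^sup>+ k. full_prob n \<mu> t (1, k) \<partial>\<mu>) \<le> (\<integral>\<^sup>+ k. comparison n \<mu> 1 k \<partial>\<mu>)" for t
    using n by (intro nn_integral_mono full_prob_le_comparison) auto
  also have "(\<integral>\<^sup>+ k. comparison n \<mu> 1 k \<partial>\<mu>) = (\<integral>\<^sup>+ ks. ennreal (coupon n (sum_list ks) 1) \<partial>replicate_pmf (n - 1) \<mu>)"
    unfolding r comparison_def by simp
  finally show ?thesis using n by (subst emeasure_Trans_Sup) (auto intro: SUP_least)
qed

end

subsection \<open>Generating functions\<close>

text \<open>With \<open>m = n - N\<close> every draw must be new, which gives the product
  \<open>(n - N) / n * ... * 1 / n\<close>. This exact value takes the place of the saddle-point
  estimates at \<open>s = 0\<close>.\<close>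

lemma coupon_early:
  assumes "n \<ge> 1"
  shows "N \<le> n \<Longrightarrow> (m < n - N \<longrightarrow> coupon n m N = 0) \<and> (m = n - N \<longrightarrow> coupon n m N = fact m / real n ^ m)"
proof (induction m arbitrary: N)
  case (Suc m)
  show ?case
  proof (cases "N = n")
    case False
    then have N: "Suc N \<le> n" using Suc.prems by simp
    have 1: "(1 - real N / real n) * (fact m / real n ^ m) = fact (Suc m) / real n ^ Suc m" if "Suc m = n - N"
    proof -
      have "n = N + Suc m" using that Suc.prems by simp
      then have "1 - real N / real n = real (Suc m) / real n" using assms by (simp add: field_simps)
      then show ?thesis by simp
    qed
    show ?thesis
    proof (intro conjI impI)
      assume "Suc m < n - N"
      then show "coupon n (Suc m) N = 0" using Suc.IH[OF N] Suc.IH[OF Suc.prems] by simp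
    next
      assume a: "Suc m = n - N"
      then have "m < n - N" "m = n - Suc N" by auto
      then have "coupon n m N = 0" "coupon n m (Suc N) = fact m / real n ^ m"
        using Suc.IH[OF N] Suc.IH[OF Suc.prems] by (blast, blast)
      then show "coupon n (Suc m) N = fact (Suc m) / real n ^ Suc m"
        unfolding coupon.simps using 1[OF a] by simp
    qed
  qed auto
qed auto

lemma coupon_mono_N:
  assumes "n \<ge> 1"
  shows "N < n \<Longrightarrow> coupon n m N \<le> coupon n m (Suc N)"
proof (induction m arbitrary: N)
  case (Suc m)
  have p: "0 \<le> real N / real n" "real N / real n \<le> 1" using Suc.prems by auto
  have "coupon n (Suc m) N \<le> coupon n m (Suc N)"
    using convex_bound_le[of "coupon n m N" "coupon n m (Suc N)" "coupon n m (Suc N)" "real N / real n" "1 - real N / real n"]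
      Suc.IH[OF Suc.prems] p by simp
  also have "\<dots> \<le> coupon n (Suc m) (Suc N)"
  proof (cases "Suc N = n")
    case True
    then show ?thesis using coupon_full[OF assms, of m] coupon_full[OF assms, of "Suc m"] by (simp only: order_refl)
  next
    case False
    define q where "q = real (Suc N) / real n"
    have q: "0 \<le> q" "q \<le> 1" using Suc.prems by (auto simp: q_def)
    have "coupon n m (Suc N) \<le> coupon n m (Suc (Suc N))" using Suc.IH[of "Suc N"] Suc.prems False by simp
    then have "(1 - q) * coupon n m (Suc N) \<le> (1 - q) * coupon n m (Suc (Suc N))" using q by (intro mult_left_mono) auto
    then show ?thesis unfolding coupon.simps q_def[symmetric] by (simp add: algebra_simps)
  qed
  finally show ?case .
qed auto

text \<open>Concentration will bound \<open>coupon\<close> from below at one uncontrolled number of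
  draws; monotonicity carries the bound to all larger ones.\<close>

lemma coupon_mono:
  assumes "n \<ge> 1" "N \<le> n" "m \<le> m'"
  shows "coupon n m N \<le> coupon n m' N"
proof -
  have "coupon n m N \<le> coupon n (Suc m) N" for m
  proof (cases "N = n")
    case True
    then show ?thesis using coupon_full[OF assms(1), of m] coupon_full[OF assms(1), of "Suc m"] by (simp only: order_refl)
  next
    case False
    define q where "q = real N / real n"
    have q: "0 \<le> q" "q \<le> 1" using assms by (auto simp: q_def)
    have "coupon n m N \<le> coupon n m (Suc N)" using coupon_mono_N[OF assms(1)] assms False by simp
    then have "(1 - q) * coupon n m N \<le> (1 - q) * coupon n m (Suc N)" using q by (intro mult_left_mono) auto
    then show ?thesis unfolding coupon.simps q_def[symmetric] by (simp add: algebra_simps)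
  qed
  from lift_Suc_mono_le[of "\<lambda>m. coupon n m N", OF this assms(3)] show ?thesis .
qed

text \<open>Exponential generating function of the words in which \<open>N\<close> letters are free
  (factor \<open>exp z\<close> each) and \<open>n - N\<close> letters must occur (factor
  \<open>exp z - 1\<close> each). The recursion for \<open>coupon\<close> is the differential
  equation \<open>D\<close> below.\<close>

lemma coupon_fps:
  assumes "n \<ge> 1"
  shows "N \<le> n \<Longrightarrow> coupon n m N = fact m / real n ^ m * fps_nth (fps_exp (real N) * (fps_exp 1 - 1) ^ (n - N)) m"
proof (induction m arbitrary: N)
  case 0
  then show ?case by (auto simp: power_0_left)
next
  case (Suc m)
  define G :: "nat \<Rightarrow> real fps" where "G N = fps_exp (real N) * (fps_exp 1 - 1) ^ (n - N)" for N
  have D: "fps_deriv (G N) = fps_const (real N) * G N + fps_const (real n - real N) * G (Suc N)"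
  proof (cases "N = n")
    case True
    then show ?thesis by (simp add: G_def)
  next
    case False
    then obtain r where r: "n - N = Suc r" using Suc.prems by (metis Suc_diff_Suc le_neq_implies_less)
    have c: "real n - real N = real (Suc r)" 
    proof -
      have "n = N + Suc r" using r Suc.prems by simp
      then show ?thesis by simp
    qed
    have r': "n - Suc N = r" using r by simp
    have e: "fps_exp (real (Suc N)) = fps_exp 1 * fps_exp (real N)"
      by (simp add: fps_exp_add_mult[symmetric])
    have dE: "fps_deriv ((fps_exp 1 - 1 :: real fps) ^ Suc r) = fps_const (real (Suc r)) * fps_exp 1 * (fps_exp 1 - 1) ^ r"
      by (simp add: fps_deriv_power del: power_Suc of_nat_Suc)
    show ?thesis unfolding G_def r r' c e fps_deriv_mult dE
      by (simp add: algebra_simps del: power_Suc of_nat_Suc)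
  qed
  have f: "(fact (Suc m) :: real) = real (Suc m) * fact m" by simp
  have "(fact (Suc m) / real n ^ Suc m) * fps_nth (G N) (Suc m) = fact m / (real n * real n ^ m) * fps_nth (fps_deriv (G N)) m"
    by (simp only: f fps_deriv_nth power_Suc) simp
  also have "\<dots> = real N / real n * (fact m / real n ^ m * fps_nth (G N) m)
      + (real n - real N) / real n * (fact m / real n ^ m * fps_nth (G (Suc N)) m)"
  proof -
    have *: "fact m / (real n * a) * (real N * x + d * y) = real N / real n * (fact m / a * x) + d / real n * (fact m / a * y)" for a d x y :: real
      by (simp add: add_divide_distrib algebra_simps)
    show ?thesis unfolding D fps_add_nth fps_mult_left_const_nth by (rule *)
  qed
  also have "\<dots> = coupon n (Suc m) N"
  proof (cases "N = n")
    case True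
    then show ?thesis using Suc.IH[OF Suc.prems] assms by (simp add: G_def)
  next
    case False
    have "(real n - real N) / real n = 1 - real N / real n" using assms by (simp add: field_simps)
    then show ?thesis using Suc.IH[OF Suc.prems] Suc.IH[of "Suc N"] Suc.prems False by (simp add: G_def)
  qed
  finally show ?case by (simp add: G_def)
qed

section \<open>Power series with nonnegative coefficients: saddle-point bounds and
  concentration\<close>

definition fps_sums :: "real fps \<Rightarrow> real \<Rightarrow> real \<Rightarrow> bool" where
  "fps_sums A s v \<longleftrightarrow> (\<forall>k. 0 \<le> fps_nth A k) \<and> (\<lambda>k. fps_nth A k * s ^ k) sums v"

lemma fps_sums_mult:
  assumes "fps_sums A s a" "fps_sums B s b" "s \<ge> 0"
  shows "fps_sums (A * B) s (a * b)"
  unfolding fps_sums_def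
proof (intro conjI allI)
  fix k
  show "0 \<le> fps_nth (A * B) k"
    using assms unfolding fps_sums_def by (auto simp: fps_mult_nth intro!: sum_nonneg)
next
  have sA: "summable (\<lambda>k. norm (fps_nth A k * s ^ k))" and sB: "summable (\<lambda>k. norm (fps_nth B k * s ^ k))"
    using assms unfolding fps_sums_def by (auto simp: abs_mult sums_iff)
  have "(\<lambda>k. \<Sum>i\<le>k. (fps_nth A i * s ^ i) * (fps_nth B (k - i) * s ^ (k - i))) sums (a * b)"
    using Cauchy_product_sums[OF sA sB] assms unfolding fps_sums_def by (simp add: sums_iff)
  moreover have "(\<Sum>i\<le>k. (fps_nth A i * s ^ i) * (fps_nth B (k - i) * s ^ (k - i))) = fps_nth (A * B) k * s ^ k" for k
  proof -
    have "(\<Sum>i\<le>k. (fps_nth A i * s ^ i) * (fps_nth B (k - i) * s ^ (k - i))) =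
      (\<Sum>i\<le>k. fps_nth A i * fps_nth B (k - i) * s ^ k)"
    proof (intro sum.cong refl)
      fix i assume "i \<in> {..k}"
      then have "s ^ i * s ^ (k - i) = s ^ k" by (simp add: power_add[symmetric])
      then show "(fps_nth A i * s ^ i) * (fps_nth B (k - i) * s ^ (k - i)) = fps_nth A i * fps_nth B (k - i) * s ^ k"
        by (metis mult.assoc mult.left_commute)
    qed
    then show ?thesis by (simp add: fps_mult_nth sum_distrib_right atLeast0AtMost)
  qed
  ultimately show "(\<lambda>k. fps_nth (A * B) k * s ^ k) sums (a * b)" by simp
qed

lemma fps_sums_1: "fps_sums 1 s 1"
proof -
  have "(\<lambda>k. fps_nth 1 k * s ^ k) = (\<lambda>k. if k = 0 then 1 else 0)"
    by (rule ext) (simp add: fps_one_nth)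
  then show ?thesis using sums_single[of 0 "\<lambda>_. 1::real"] by (simp add: fps_sums_def)
qed

lemma fps_sums_power: "fps_sums A s a \<Longrightarrow> s \<ge> 0 \<Longrightarrow> fps_sums (A ^ n) s (a ^ n)"
  by (induction n) (simp_all add: fps_sums_1 fps_sums_mult)

text \<open>One term of a series of nonnegative terms: the Chernoff or saddle-point upper bound,
  used for factorials, for the coupon collector and for sums of \<open>K\<close>'s.\<close>

lemma fps_sums_nth_le:
  assumes "fps_sums A s v" "s \<ge> 0"
  shows "fps_nth A k * s ^ k \<le> v"
proof -
  have "sum (\<lambda>k. fps_nth A k * s ^ k) {k} \<le> (\<Sum>k. fps_nth A k * s ^ k)"
    using assms unfolding fps_sums_def by (intro sum_le_suminf) (auto simp: sums_iff)
  then show ?thesis using assms unfolding fps_sums_def by (simp add: sums_iff)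
qed

lemma fps_sums_exp: "c \<ge> 0 \<Longrightarrow> fps_sums (fps_exp c) s (exp (c * s))"
proof -
  assume c: "c \<ge> 0"
  have "(c * s) ^ k /\<^sub>R fact k = fps_nth (fps_exp c) k * s ^ k" for k
    by (simp add: power_mult_distrib divide_inverse)
  then show ?thesis using exp_converges[of "c * s"] c unfolding fps_sums_def by simp
qed

lemma fps_sums_exp_minus_1: "fps_sums (fps_exp 1 - 1) s (exp s - 1)"
proof -
  have "(\<lambda>k. fps_nth (fps_exp 1) k * s ^ k - fps_nth 1 k * s ^ k) sums (exp s - 1)"
    using fps_sums_exp[of 1 s] fps_sums_1[of s] unfolding fps_sums_def by (intro sums_diff) auto
  then show ?thesis by (auto simp: fps_sums_def algebra_simps)
qed

text \<open>The Euler operator \<open>z d/dz\<close>: it multiplies the \<open>k\<close>-th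
  coefficient by \<open>k\<close>, so its iterates generate the moments of the index.\<close>

definition fps_theta :: "real fps \<Rightarrow> real fps" where
  "fps_theta A = fps_X * fps_deriv A"

lemma fps_theta_nth: "fps_nth (fps_theta A) k = real k * fps_nth A k"
  by (cases k) (auto simp: fps_theta_def)

lemma fps_theta_mult: "fps_theta (A * B) = fps_theta A * B + A * fps_theta B"
  by (simp add: fps_theta_def algebra_simps)

lemma fps_theta_power: "fps_theta (A ^ Suc n) = of_nat (Suc n) * (A ^ n * fps_theta A)"
  by (simp add: fps_theta_def fps_deriv_power' algebra_simps del: of_nat_Suc power_Suc)

text \<open>Chebyshev's inequality: the variance of the weights \<open>(A ^ N)\<^sub>k s ^ k\<close> is linear in \<open>N\<close>.\<close>

lemma fps_power_concentration:
  assumes A: "fps_sums A s g0" and A1: "fps_sums (fps_theta A) s g1"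
    and A2: "fps_sums (fps_theta (fps_theta A)) s g2" and s: "s \<ge> 0" and g0: "g0 > 0" and \<delta>: "\<delta> > 0"
  shows "\<forall>\<^sub>F N in sequentially. \<exists>k. \<bar>real k / real N - g1 / g0\<bar> \<le> \<delta> \<and>
    g0 ^ N * exp (- \<delta> * real N) \<le> fps_nth (A ^ N) k * s ^ k"
proof -
  \<comment> \<open>Mean and variance of the index \<open>k\<close> under the probability weights
    \<open>fps_nth A k * s ^ k / g0\<close>.\<close>
  define m where "m = g1 / g0"
  define v where "v = g2 / g0 - m\<^sup>2"
  \<comment> \<open>The first term will bound the share of the window around
    \<open>m * real N\<close> if all its weights are small, the second the share outside, by
    Chebyshev.\<close>
  have "(\<lambda>N. ((m + \<delta>) * real N + 1) * exp (- \<delta> * real N) + v / (\<delta>\<^sup>2 * real N)) \<longlonglongrightarrow> 0"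
    using \<delta> by real_asymp
  then have ev: "\<forall>\<^sub>F N in sequentially. ((m + \<delta>) * real N + 1) * exp (- \<delta> * real N) + v / (\<delta>\<^sup>2 * real N) < 1"
    by (rule order_tendstoD) simp
  have g1: "g1 \<ge> 0"
  proof (rule sums_le[OF _ sums_zero])
    show "(\<lambda>k. fps_nth (fps_theta A) k * s ^ k) sums g1" using A1 unfolding fps_sums_def by blast
    show "0 \<le> fps_nth (fps_theta A) k * s ^ k" for k using A1 s unfolding fps_sums_def by simp
  qed
  then have m0: "m \<ge> 0" using g0 by (simp add: m_def)
  show ?thesis using ev eventually_ge_at_top[of 2]
  proof eventually_elim
    case (elim N)
    define B where "B = A ^ N"
    define b where "b k = fps_nth B k * s ^ k" for k
    \<comment> \<open>Two applications of \<open>fps_theta\<close> lower the exponent by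
      two.\<close>
    obtain r where r: "N = Suc (Suc r)" using elim(2) by (metis add_2_eq_Suc le_Suc_ex)
    have N0: "real N > 0" using elim(2) by simp
    have B: "fps_sums B s (g0 ^ N)" unfolding B_def by (rule fps_sums_power[OF A s])
    have b0: "b k \<ge> 0" for k using B s unfolding fps_sums_def b_def by auto
    have S0: "b sums (g0 ^ N)" using B unfolding fps_sums_def b_def by blast
    have of_nat: "fps_nth (of_nat j * F) k = real j * fps_nth F k" for j k and F :: "real fps"
      by (simp add: fps_of_nat[symmetric])
    have th1: "fps_theta B = of_nat N * (A ^ Suc r * fps_theta A)"
      unfolding B_def r by (rule fps_theta_power)
    have "fps_sums (A ^ Suc r * fps_theta A) s (g0 ^ Suc r * g1)"
      by (intro fps_sums_mult fps_sums_power A A1 s)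
    then have "(\<lambda>k. real N * (fps_nth (A ^ Suc r * fps_theta A) k * s ^ k)) sums (real N * (g0 ^ Suc r * g1))"
      unfolding fps_sums_def by (intro sums_mult) auto
    moreover have "real N * (fps_nth (A ^ Suc r * fps_theta A) k * s ^ k) = real k * b k" for k
      using fps_theta_nth[of B k] unfolding th1 of_nat b_def by (metis mult.assoc)
    ultimately have S1: "(\<lambda>k. real k * b k) sums (real N * (g0 ^ Suc r * g1))"
      by (simp only:)
    have "fps_theta (fps_theta B) = fps_theta (fps_const (real N) * (A ^ Suc r * fps_theta A))"
      unfolding th1 by (simp add: fps_of_nat[symmetric])
    also have "\<dots> = fps_const (real N) * fps_theta (A ^ Suc r * fps_theta A)"
      by (rule fps_ext) (simp add: fps_theta_nth)
    also have "fps_theta (A ^ Suc r * fps_theta A) = of_nat (Suc r) * (A ^ r * fps_theta A * fps_theta A) + A ^ Suc r * fps_theta (fps_theta A)"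
      unfolding fps_theta_mult fps_theta_power by (simp add: mult.assoc)
    finally have th2: "fps_theta (fps_theta B) = fps_const (real N) *
      (of_nat (Suc r) * (A ^ r * fps_theta A * fps_theta A) + A ^ Suc r * fps_theta (fps_theta A))" .
    have e1: "fps_sums (A ^ r * fps_theta A * fps_theta A) s (g0 ^ r * g1 * g1)"
      by (intro fps_sums_mult fps_sums_power A A1 s)
    have e2: "fps_sums (A ^ Suc r * fps_theta (fps_theta A)) s (g0 ^ Suc r * g2)"
      by (intro fps_sums_mult fps_sums_power A A2 s)
    have "(\<lambda>k. real N * (real (Suc r) * (fps_nth (A ^ r * fps_theta A * fps_theta A) k * s ^ k) +
        fps_nth (A ^ Suc r * fps_theta (fps_theta A)) k * s ^ k)) sums
        (real N * (real (Suc r) * (g0 ^ r * g1 * g1) + g0 ^ Suc r * g2))"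
      using e1 e2 unfolding fps_sums_def by (intro sums_mult sums_add) auto
    moreover have "real N * (real (Suc r) * (fps_nth (A ^ r * fps_theta A * fps_theta A) k * s ^ k) +
        fps_nth (A ^ Suc r * fps_theta (fps_theta A)) k * s ^ k) = real k * real k * b k" for k
    proof -
      have "fps_nth (fps_theta (fps_theta B)) k = real N * (real (Suc r) * fps_nth (A ^ r * fps_theta A * fps_theta A) k +
        fps_nth (A ^ Suc r * fps_theta (fps_theta A)) k)"
        unfolding th2 by (simp only: fps_mult_left_const_nth fps_add_nth of_nat)
      then have "real k * (real k * fps_nth B k) = real N * (real (Suc r) * fps_nth (A ^ r * fps_theta A * fps_theta A) k +
        fps_nth (A ^ Suc r * fps_theta (fps_theta A)) k)" by (simp only: fps_theta_nth)
      then have "real k * (real k * fps_nth B k) * s ^ k = real N * (real (Suc r) * fps_nth (A ^ r * fps_theta A * fps_theta A) k +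
        fps_nth (A ^ Suc r * fps_theta (fps_theta A)) k) * s ^ k" by simp
      then show ?thesis unfolding b_def by (simp only: algebra_simps)
    qed
    ultimately have S2: "(\<lambda>k. real k * real k * b k) sums (real N * (real (Suc r) * (g0 ^ r * g1 * g1) + g0 ^ Suc r * g2))"
      by simp
    have "(\<lambda>k. real k * real k * b k - 2 * m * real N * (real k * b k) + (m * real N)\<^sup>2 * b k) sums
      (real N * (real (Suc r) * (g0 ^ r * g1 * g1) + g0 ^ Suc r * g2) - 2 * m * real N * (real N * (g0 ^ Suc r * g1))
        + (m * real N)\<^sup>2 * g0 ^ N)"
      by (intro sums_add sums_diff sums_mult S0 S1 S2)
    moreover have "real k * real k * b k - 2 * m * real N * (real k * b k) + (m * real N)\<^sup>2 * b k = (real k - m * real N)\<^sup>2 * b k" for k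
      by (simp add: power2_eq_square algebra_simps)
    moreover have "real N * (real (Suc r) * (g0 ^ r * g1 * g1) + g0 ^ Suc r * g2) - 2 * m * real N * (real N * (g0 ^ Suc r * g1))
        + (m * real N)\<^sup>2 * g0 ^ N = g0 ^ N * (real N * v)"
    proof -
      have g: "g1 = m * g0" "g2 = (v + m\<^sup>2) * g0" using g0 by (auto simp: m_def v_def)
      show ?thesis unfolding g r by (simp add: power2_eq_square algebra_simps)
    qed
    ultimately have V: "(\<lambda>k. (real k - m * real N)\<^sup>2 * b k) sums (g0 ^ N * (real N * v))" by simp
    show ?case
    proof (rule ccontr)
      assume no: "\<not> ?thesis"
      define c where "c = g0 ^ N * exp (- \<delta> * real N)"
      have c0: "c \<ge> 0" using g0 by (simp add: c_def)
      define W where "W = {k. \<bar>real k - m * real N\<bar> \<le> \<delta> * real N}"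
      have Wsub: "W \<subseteq> {..nat \<lfloor>(m + \<delta>) * real N\<rfloor>}"
      proof
        fix k assume "k \<in> W"
        then have "real k \<le> (m + \<delta>) * real N" by (auto simp: W_def algebra_simps abs_le_iff)
        then show "k \<in> {..nat \<lfloor>(m + \<delta>) * real N\<rfloor>}" by (simp add: le_nat_floor)
      qed
      then have fW: "finite W" using finite_subset by blast
      have "card W \<le> nat \<lfloor>(m + \<delta>) * real N\<rfloor> + 1" using card_mono[OF _ Wsub] by simp
      moreover have "real (nat \<lfloor>(m + \<delta>) * real N\<rfloor>) \<le> (m + \<delta>) * real N"
        using m0 \<delta> by (intro of_nat_floor) auto
      ultimately have cW: "real (card W) \<le> (m + \<delta>) * real N + 1" by linarith
      \<comment> \<open>In the window the assumed failure bounds the weight by \<open>c\<close>;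
        outside, the squared deviation is at least \<open>(\<delta> * real N)\<close>
        squared.\<close>
      have ptw: "b k \<le> (if k \<in> W then c else 0) + (real k - m * real N)\<^sup>2 * b k / (\<delta> * real N)\<^sup>2" for k
      proof (cases "k \<in> W")
        case True
        have "\<bar>real k / real N - m\<bar> = \<bar>real k - m * real N\<bar> / real N"
          using N0 by (simp add: abs_div_pos[symmetric] field_simps)
        also have "\<dots> \<le> \<delta>" using True N0 by (simp add: W_def field_simps)
        finally have "b k \<le> c" using no unfolding m_def c_def b_def B_def by (meson not_le_imp_less less_imp_le)
        then show ?thesis using True b0[of k] by (simp add: add_increasing2)
      next
        case False
        then have "(\<delta> * real N)\<^sup>2 \<le> (real k - m * real N)\<^sup>2"
          using \<delta> N0 unfolding W_def by (subst abs_le_square_iff[symmetric]) auto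
        then have "(\<delta> * real N)\<^sup>2 * b k \<le> (real k - m * real N)\<^sup>2 * b k" using b0 by (rule mult_right_mono)
        then show ?thesis using False \<delta> N0 by (simp add: field_simps)
      qed
      have "(\<lambda>k. (if k \<in> W then c else 0) + (real k - m * real N)\<^sup>2 * b k / (\<delta> * real N)\<^sup>2) sums
        ((\<Sum>k\<in>W. c) + g0 ^ N * (real N * v) / (\<delta> * real N)\<^sup>2)"
        by (intro sums_add sums_If_finite_set fW sums_divide V)
      from sums_le[OF ptw S0 this] have "g0 ^ N \<le> real (card W) * c + g0 ^ N * (real N * v) / (\<delta> * real N)\<^sup>2" by simp
      also have "\<dots> \<le> ((m + \<delta>) * real N + 1) * c + g0 ^ N * (real N * v) / (\<delta> * real N)\<^sup>2"
        using cW c0 by (intro add_right_mono mult_right_mono) auto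
      also have "\<dots> = g0 ^ N * (((m + \<delta>) * real N + 1) * exp (- \<delta> * real N) + v / (\<delta>\<^sup>2 * real N))"
        using N0 by (simp add: c_def field_simps power2_eq_square)
      also have "\<dots> < g0 ^ N * 1" using elim(1) g0 by (intro mult_strict_left_mono) auto
      finally show False by simp
    qed
  qed
qed

subsection \<open>The coupon collector's rate\<close>

text \<open>The term of index \<open>k\<close> in the exponential series at \<open>k\<close> is at
  most \<open>exp k\<close>.\<close>

lemma fact_ge: "k ^ k * exp (- real k) \<le> fact k"
proof -
  have "fps_nth (fps_exp 1) k * real k ^ k \<le> exp (1 * real k)"
    by (intro fps_sums_nth_le fps_sums_exp) auto
  then show ?thesis by (simp add: exp_minus field_simps)
qed

text \<open>Induction through \<open>(1 - 1 / (k + 1)) ^ (k + 1) \<le> exp (- 1)\<close>. A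
  polynomial excess over \<open>k ^ k * exp (- k)\<close> is harmless here.\<close>

lemma fact_le: "k \<ge> 1 \<Longrightarrow> fact k \<le> exp 1 * real k * (real k ^ k * exp (- real k))"
proof (induction k rule: dec_induct)
  case base
  show ?case by (simp add: exp_minus)
next
  case (step k)
  have k: "real k > 0" using step by simp
  have "(1 - 1 / real (Suc k)) ^ Suc k \<le> exp (- 1 / real (Suc k)) ^ Suc k"
    using exp_ge_add_one_self[of "- 1 / real (Suc k)"] by (intro power_mono) auto
  also have "\<dots> = exp (- 1)" by (simp add: exp_of_nat_mult[symmetric] del: power_Suc of_nat_Suc)
  also have "1 - 1 / real (Suc k) = real k / real (Suc k)" by (simp add: field_simps)
  finally have "real k ^ Suc k \<le> real (Suc k) ^ Suc k * exp (- 1)"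
    unfolding power_divide by (subst (asm) pos_divide_le_eq) (auto simp: mult.commute simp del: power_Suc of_nat_Suc)
  then have "exp 1 * exp (- real k) * real k ^ Suc k \<le> exp 1 * exp (- real k) * (real (Suc k) ^ Suc k * exp (- 1))"
    by (intro mult_left_mono) auto
  also have "\<dots> = exp 1 * (real (Suc k) ^ Suc k * exp (- real (Suc k)))"
  proof -
    have "exp (- real (Suc k)) = exp (- real k) * exp (- 1)" by (simp add: exp_add[symmetric])
    then show ?thesis by (simp only: mult_ac)
  qed
  finally have *: "exp 1 * real k * (real k ^ k * exp (- real k)) \<le> exp 1 * (real (Suc k) ^ Suc k * exp (- real (Suc k)))"
    by (simp add: mult_ac)
  have "fact (Suc k) = real (Suc k) * fact k" by simp
  also have "\<dots> \<le> real (Suc k) * (exp 1 * (real (Suc k) ^ Suc k * exp (- real (Suc k))))"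
    by (intro mult_left_mono order.trans[OF step.IH *]) auto
  finally show ?case by (simp only: mult_ac)
qed

text \<open>The exponential rate of decay of \<open>coupon (Suc N) k 1\<close> for \<open>k\<close>
  close to \<open>lam s * N\<close>.\<close>

definition coupon_rate :: "real \<Rightarrow> real" where
  "coupon_rate s = (lam s - 1) * ln (1 - exp (- s)) + lam s * exp (- s)"

lemma coupon_rate_0: "coupon_rate 0 = 1"
  by (simp add: coupon_rate_def lam_def)

lemma exp_minus_lt_1: "s > 0 \<Longrightarrow> exp (- s) < (1::real)" by simp

lemma lam_ge:
  assumes "s \<ge> 0"
  shows "lam s \<ge> 1" "lam s \<ge> s"
proof -
  have "s / (1 - exp (- s)) \<ge> 1" if "s > 0"
    using that exp_ge_add_one_self[of "- s"] exp_minus_lt_1[OF that] by (simp add: field_simps)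
  then show "lam s \<ge> 1" using assms by (auto simp: lam_def)
  have "s / (1 - exp (- s)) \<ge> s" if "s > 0"
    using that exp_minus_lt_1[OF that] by (simp add: field_simps)
  then show "lam s \<ge> s" using assms by (auto simp: lam_def)
qed

text \<open>The left-hand side is the exponent per server of
  \<open>fact k / N ^ k * (exp s - 1) ^ N / s ^ k\<close> at \<open>k = x * N\<close>,
  \<open>x = lam s\<close>; Stirling turns \<open>fact k / N ^ k\<close> into
  \<open>x * ln x - x\<close>.\<close>

lemma coupon_rate_eq:
  assumes "s > 0"
  shows "lam s * ln (lam s) - lam s - lam s * ln s + ln (exp s - 1) = - coupon_rate s"
proof -
  define p where "p = 1 - exp (- s)"
  have p: "p > 0" using exp_minus_lt_1[OF assms] by (simp add: p_def)
  have "exp s - 1 = exp s * p" by (simp add: p_def algebra_simps exp_add[symmetric])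
  then have 1: "ln (exp s - 1) = s + ln p" using p by (simp add: ln_mult)
  have l: "lam s = s / p" using assms by (simp add: lam_def p_def)
  then have 2: "ln (lam s) = ln s - ln p" using assms p by (simp add: ln_div)
  have s: "s = lam s * p" using l p by simp
  have "lam s * (1 - p) - lam s = - s" using s by (simp add: algebra_simps)
  moreover have e: "exp (- s) = 1 - p" by (simp add: p_def)
  ultimately show ?thesis unfolding coupon_rate_def 1 2 e p_def[symmetric] by (simp add: algebra_simps)
qed

text \<open>The rate vanishes at infinity; an explicit decreasing bound gives uniformity on bounded
  \<open>s\<close>. With \<open>E = exp s - 1\<close>, \<open>ln (E / (E + 1)) \<ge> - 1 / E\<close>
  yields \<open>(E - s) / E ^ 2\<close>; then \<open>E - s \<ge> s ^ 2 / 2\<close> and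
  \<open>s / E \<ge> exp (- s)\<close>.\<close>

lemma coupon_rate_pos:
  assumes "s \<ge> 0"
  shows "coupon_rate s \<ge> exp (- 2 * s) / 2"
proof (cases "s = 0")
  case True
  then show ?thesis by (simp add: coupon_rate_0)
next
  case False
  then have s: "s > 0" using assms by simp
  define E where "E = exp s - 1"
  have E: "E > 0" using s by (simp add: E_def)
  have q: "exp (- s) = 1 / (E + 1)" by (simp add: E_def exp_minus field_simps)
  have p: "1 - exp (- s) = E / (E + 1)" unfolding q using E by (simp add: field_simps)
  have l: "lam s = s * (E + 1) / E" using s by (simp add: lam_def p)
  have "ln (inverse (E / (E + 1))) \<le> inverse (E / (E + 1)) - 1" using E by (intro ln_le_minus_one) auto
  moreover have "inverse (E / (E + 1)) - 1 = 1 / E" using E by (simp add: field_simps)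
  moreover have "ln (inverse (E / (E + 1))) = - ln (E / (E + 1))" by (rule ln_inverse)
  ultimately have "ln (E / (E + 1)) \<ge> - (1 / E)" by linarith
  then have "(lam s - 1) * ln (E / (E + 1)) \<ge> (lam s - 1) * (- (1 / E))"
    using lam_ge(1)[OF assms] by (intro mult_left_mono) auto
  then have "coupon_rate s \<ge> (lam s - 1) * (- (1 / E)) + lam s * (1 / (E + 1))"
    unfolding coupon_rate_def p unfolding q by (rule add_right_mono)
  also have "(lam s - 1) * (- (1 / E)) + lam s * (1 / (E + 1)) = (E - s) / E\<^sup>2"
  proof -
    have a: "lam s * (1 / (E + 1)) = s / E" unfolding l using E by simp
    have b: "lam s = s + s / E" unfolding l using E by (simp add: field_simps)
    show ?thesis unfolding a unfolding b using E by (simp add: field_simps power2_eq_square)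
  qed
  finally have 1: "coupon_rate s \<ge> (E - s) / E\<^sup>2" .
  have "1 + s + s\<^sup>2 / 2 \<le> exp s" using exp_lower_Taylor_quadratic[OF assms] .
  then have 2: "E - s \<ge> s\<^sup>2 / 2" by (simp add: E_def)
  have "1 - s \<le> exp (- s)" using exp_ge_add_one_self[of "- s"] by simp
  then have "exp s * (1 - s) \<le> 1" by (simp add: exp_minus field_simps)
  then have "E * exp (- s) \<le> s" by (simp add: E_def exp_minus field_simps)
  then have "exp (- s) \<le> s / E" using E by (simp add: field_simps)
  then have "(exp (- s))\<^sup>2 \<le> (s / E)\<^sup>2" by (intro power_mono) auto
  then have "exp (- 2 * s) / 2 \<le> s\<^sup>2 / 2 / E\<^sup>2" by (simp add: power_divide power2_eq_square exp_add[symmetric])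
  also have "\<dots> \<le> (E - s) / E\<^sup>2" using 2 by (intro divide_right_mono) auto
  finally show ?thesis using 1 by linarith
qed

text \<open>Intermediate value theorem for \<open>s - x * (1 - exp (- s))\<close>. The bound
  \<open>s \<le> x\<close> serves to control the prefactor in \<open>coupon_le\<close>
  uniformly.\<close>

lemma lam_surj:
  assumes "x \<ge> 1"
  shows "\<exists>s. 0 \<le> s \<and> s \<le> x \<and> lam s = x"
proof (cases "x = 1")
  case True
  then show ?thesis by (intro exI[of _ 0]) (simp add: lam_def)
next
  case False
  then have x: "x > 1" using assms by simp
  define f where "f s = s - x * (1 - exp (- s))" for s
  \<comment> \<open>\<open>f 0 = 0\<close> for every \<open>x\<close>; starting from
    \<open>s0 > 0\<close>, where \<open>f\<close> is still nonpositive, excludes this spurious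
    zero.\<close>
  define s0 where "s0 = (x - 1) / x"
  have s0: "0 < s0" "s0 \<le> x" using x by (auto simp: s0_def field_simps) (smt (verit) mult_less_cancel_left1)
  have "exp (- s0) \<le> 1 / (1 + s0)"
    using exp_ge_add_one_self[of s0] s0 by (simp add: exp_minus field_simps)
  also have "\<dots> \<le> 1 - s0 / x" 
  proof -
    have "x * (1 + s0) - s0 * (1 + s0) - x \<ge> 0"
    proof -
      have e: "x * s0 = x - 1" using x by (simp add: s0_def)
      have "s0 \<le> 1" using x by (simp add: s0_def field_simps)
      moreover have "x * s0 - s0 * (1 + s0) = s0 * (x - 1 - s0)" by (simp add: algebra_simps)
      moreover have "x - 1 \<ge> s0" using x mult_left_mono[of 1 x "x - 1"] by (simp add: s0_def divide_le_eq)
      ultimately have "x * s0 - s0 * (1 + s0) \<ge> 0" using s0 by simp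
      then show ?thesis by (simp add: algebra_simps)
    qed
    then show ?thesis using s0 x by (simp add: field_simps)
  qed
  finally have "f s0 \<le> 0" using x by (simp add: f_def field_simps)
  moreover have "f x \<ge> 0" using x by (simp add: f_def)
  moreover have "continuous_on {s0..x} f" unfolding f_def by (intro continuous_intros)
  ultimately obtain s where s: "s0 \<le> s" "s \<le> x" "f s = 0" using IVT'[of f s0 0 x] s0 by auto
  have sp: "s > 0" using s s0 by simp
  then have "lam s = x" using s(3) exp_minus_lt_1[OF sp] by (simp add: lam_def f_def field_simps)
  then show ?thesis using s sp by (intro exI[of _ s]) auto
qed

text \<open>Strictness matters: a tilt at \<open>r < s\<close> must leave a gap between
  \<open>lam r\<close> and \<open>lam s\<close>.\<close>

lemma lam_strict_mono:
  assumes "0 < s" "s < t"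
  shows "lam s < lam t"
proof -
  have "(\<lambda>s. s / (1 - exp (- s))) s < (\<lambda>s. s / (1 - exp (- s))) t"
  proof (rule DERIV_pos_imp_increasing[OF assms(2)])
    fix x assume x: "s \<le> x" "x \<le> t"
    then have x0: "x > 0" using assms by simp
    have p: "1 - exp (- x) > 0" using exp_minus_lt_1[OF x0] by simp
    have "((\<lambda>s. s / (1 - exp (- s))) has_real_derivative ((1 - exp (- x) - x * exp (- x)) / (1 - exp (- x))\<^sup>2)) (at x)"
      using p by (auto intro!: derivative_eq_intros simp: power2_eq_square)
    moreover have "1 + x < exp x" using x0 exp_minus_greater[of "- x"] by simp
    then have "(1 + x) * exp (- x) < 1" by (simp add: exp_minus field_simps)
    then have "1 - exp (- x) - x * exp (- x) > 0" by (simp add: algebra_simps)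
    ultimately show "\<exists>y. ((\<lambda>s. s / (1 - exp (- s))) has_real_derivative y) (at x) \<and> y > 0"
      using p by (intro exI conjI) (assumption, auto)
  qed
  then show ?thesis using assms by (simp add: lam_def)
qed

lemma power_eq_exp: "x > 0 \<Longrightarrow> real N > 0 \<Longrightarrow> real k = x * real N \<Longrightarrow> (y::real) > 0 \<Longrightarrow> y ^ k = exp (real N * (x * ln y))"
  by (simp add: powr_realpow[symmetric] powr_def mult_ac)

text \<open>The coefficient bound at the saddle point \<open>s\<close>. In
  \<open>exp (s + 1)\<close> the \<open>1\<close> comes from \<open>fact_le\<close> and the
  \<open>s\<close> from the factor \<open>exp z\<close> of the server known at the start.\<close>

lemma coupon_le:
  assumes N: "N \<ge> 1" and s: "s \<ge> 0" and k: "real k = lam s * real N"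
  shows "coupon (Suc N) k 1 \<le> exp (s + 1) * real k * exp (- real N * coupon_rate s)"
proof -
  have kN: "k \<ge> N" using k lam_ge(1)[OF s] N
    by (metis mult_le_cancel_right1 of_nat_le_iff of_nat_less_0_iff)
  then have k1: "k \<ge> 1" using N by simp
  show ?thesis
  proof (cases "s = 0")
    \<comment> \<open>The coefficient bound would divide by \<open>s ^ k = 0\<close>; here
      \<open>k = N\<close> and the exact value is available.\<close>
    case True
    then have kN: "k = N" using k by (simp add: lam_def)
    have "coupon (Suc N) k 1 = fact N / real (Suc N) ^ N" using coupon_early[of "Suc N" 1 N] N kN by simp
    also have "\<dots> \<le> fact N / real N ^ N" using N by (intro divide_left_mono power_mono) auto
    also have "\<dots> \<le> exp 1 * real N * (real N ^ N * exp (- real N)) / real N ^ N"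
      using fact_le[OF N] by (intro divide_right_mono) auto
    finally show ?thesis using N True kN by (simp add: coupon_rate_0)
  next
    case False
    then have s: "s > 0" using s by simp
    define x where "x = lam s"
    have x: "x > 0" "real k = x * real N" using lam_ge(1)[of s] s k by (auto simp: x_def)
    have N0: "real N > 0" using N by simp
    have E: "exp s - 1 > 0" using s by simp
    have "fps_nth (fps_exp (real 1) * (fps_exp 1 - 1) ^ N) k * s ^ k \<le> exp (real 1 * s) * (exp s - 1) ^ N"
      using s by (intro fps_sums_nth_le[of _ s] fps_sums_mult fps_sums_exp fps_sums_power fps_sums_exp_minus_1) auto
    then have c: "fps_nth (fps_exp (real 1) * (fps_exp 1 - 1) ^ N) k \<le> exp s * (exp s - 1) ^ N / s ^ k"
      using s by (simp add: field_simps)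
    have "coupon (Suc N) k 1 = fact k / real (Suc N) ^ k * fps_nth (fps_exp (real 1) * (fps_exp 1 - 1) ^ N) k"
      using coupon_fps[of "Suc N" 1 k] by simp
    also have "\<dots> \<le> fact k / real (Suc N) ^ k * (exp s * (exp s - 1) ^ N / s ^ k)"
      by (intro mult_left_mono c) auto
    also have "\<dots> \<le> fact k / real N ^ k * (exp s * (exp s - 1) ^ N / s ^ k)"
      using s N by (intro mult_right_mono divide_left_mono power_mono) auto
    also have "\<dots> \<le> (exp 1 * real k * (real k ^ k * exp (- real k))) / real N ^ k * (exp s * (exp s - 1) ^ N / s ^ k)"
      using s by (intro mult_right_mono divide_right_mono fact_le k1) auto
    also have "\<dots> = exp (s + 1) * real k * (x ^ k / s ^ k * exp (- real k) * (exp s - 1) ^ N)"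
      using N0 unfolding x(2) power_mult_distrib by (simp add: exp_add field_simps)
    also have "x ^ k / s ^ k * exp (- real k) * (exp s - 1) ^ N = exp (- real N * coupon_rate s)"
    proof -
      have "(exp s - 1) ^ N = exp (real N * (1 * ln (exp s - 1)))" by (rule power_eq_exp) (use N0 E in auto)
      then have "x ^ k / s ^ k * exp (- real k) * (exp s - 1) ^ N =
        exp (real N * (x * ln x) - real N * (x * ln s) - x * real N + real N * ln (exp s - 1))"
        unfolding power_eq_exp[OF x(1) N0 x(2) x(1)] power_eq_exp[OF x(1) N0 x(2) s] x(2)
        by (simp add: exp_add exp_diff exp_minus field_simps)
      also have "real N * (x * ln x) - real N * (x * ln s) - x * real N + real N * ln (exp s - 1) =
        real N * (x * ln x - x - x * ln s + ln (exp s - 1))" by (simp add: algebra_simps)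
      also have "\<dots> = - real N * coupon_rate s" unfolding x_def coupon_rate_eq[OF s] by simp
      finally show ?thesis .
    qed
    finally show ?thesis .
  qed
qed

text \<open>At \<open>k = N\<close> the exact value is
  \<open>fact N / (N + 1) ^ N \<ge> exp (- N) * (N / (N + 1)) ^ N\<close>; the last factor is at
  least \<open>exp (- 1)\<close>, which \<open>\<epsilon>\<close> absorbs.\<close>

lemma coupon_ge_0:
  assumes \<epsilon>: "\<epsilon> > 0"
  shows "\<forall>\<^sub>F N in sequentially. \<forall>k\<ge>N. exp (- real N * (1 + \<epsilon>)) \<le> coupon (Suc N) k 1"
proof -
  have "((\<lambda>N. exp (- \<epsilon> * real N)) \<longlonglongrightarrow> 0)" using \<epsilon> by real_asymp
  then have "\<forall>\<^sub>F N in sequentially. exp (- \<epsilon> * real N) < exp (- 1)"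
    by (rule order_tendstoD) simp
  then show ?thesis using eventually_ge_at_top[of 1]
  proof eventually_elim
    case (elim N)
    have N0: "real N > 0" using elim by simp
    have "exp (- real N * (1 + \<epsilon>)) = exp (- real N) * exp (- \<epsilon> * real N)"
      by (simp add: exp_add[symmetric] algebra_simps)
    also have "\<dots> \<le> exp (- real N) * exp (- 1)" using elim by (intro mult_left_mono) auto
    also have "\<dots> \<le> exp (- real N) * (real N / real (Suc N)) ^ N"
    proof (intro mult_left_mono)
      have "(1 + 1 / real N) ^ N \<le> exp (1 / real N) ^ N"
        using exp_ge_add_one_self[of "1 / real N"] by (intro power_mono) auto
      also have "\<dots> = exp 1" using N0 by (simp add: exp_of_nat_mult[symmetric])
      finally have "inverse (exp 1) \<le> inverse ((1 + 1 / real N) ^ N)" by (intro le_imp_inverse_le zero_less_power add_pos_nonneg) auto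
      also have "\<dots> = (real N / real (Suc N)) ^ N" using N0 by (simp add: power_inverse[symmetric] field_simps)
      finally show "exp (- 1) \<le> (real N / real (Suc N)) ^ N" by (simp add: exp_minus)
    qed auto
    also have "\<dots> = (real N ^ N * exp (- real N)) / real (Suc N) ^ N" by (simp add: power_divide)
    also have "\<dots> \<le> fact N / real (Suc N) ^ N" using fact_ge[of N] by (intro divide_right_mono) auto
    also have "\<dots> = coupon (Suc N) N 1" using coupon_early[of "Suc N" 1 N] by simp
    finally show ?case using coupon_mono[of "Suc N" 1 N] by (auto intro: order.trans)
  qed
qed

text \<open>Tilting at \<open>s\<close> itself would give some \<open>k\<close> near
  \<open>lam s * N\<close>, perhaps above it. Tilting at \<open>r\<close> slightly below
  \<open>s\<close> places \<open>k\<close> below \<open>lam s * N\<close>, and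
  \<open>coupon_mono\<close> reaches all required numbers of draws. One quarter of
  \<open>\<epsilon>\<close> each pays for moving \<open>s\<close> to \<open>r\<close>, for moving
  \<open>x\<close> off \<open>x0\<close>, for the concentration and for the passage from
  \<open>N\<close> to \<open>Suc N\<close>.\<close>

lemma coupon_ge:
  assumes s: "s > 0" and \<epsilon>: "\<epsilon> > 0"
  shows "\<forall>\<^sub>F N in sequentially. \<forall>k. lam s * real N \<le> real k \<longrightarrow>
    exp (- real N * (coupon_rate s + \<epsilon>)) \<le> coupon (Suc N) k 1"
proof -
  have "isCont coupon_rate s"
  proof -
    have "isCont (\<lambda>s. (s / (1 - exp (- s)) - 1) * ln (1 - exp (- s)) + s / (1 - exp (- s)) * exp (- s)) s"
      using exp_minus_lt_1[OF s] by (intro continuous_intros) auto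
    moreover have "\<forall>\<^sub>F t in nhds s. coupon_rate t = (t / (1 - exp (- t)) - 1) * ln (1 - exp (- t)) + t / (1 - exp (- t)) * exp (- t)"
      using eventually_nhds_in_open[of "{0<..}" s] s by (auto elim!: eventually_mono simp: coupon_rate_def lam_def)
    ultimately show ?thesis by (simp add: isCont_cong)
  qed
  then obtain d where d: "d > 0" "\<And>t. \<bar>t - s\<bar> < d \<Longrightarrow> \<bar>coupon_rate t - coupon_rate s\<bar> < \<epsilon> / 4"
    using \<epsilon> unfolding continuous_at_eps_delta dist_real_def by (metis zero_less_divide_iff zero_less_numeral)
  define r where "r = max (s / 2) (s - d / 2)"
  have r: "0 < r" "r < s" "\<bar>r - s\<bar> < d" using s d(1) by (auto simp: r_def)
  define x0 where "x0 = lam r"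
  have x0: "x0 \<ge> 1" "x0 < lam s" using lam_ge(1)[of r] lam_strict_mono[OF r(1,2)] r by (auto simp: x0_def)
  define h where "h x = x * ln x - x - x * ln r" for x
  have "isCont h x0" unfolding h_def using x0 by (intro continuous_intros) auto
  then obtain e where e: "e > 0" "\<And>x. \<bar>x - x0\<bar> < e \<Longrightarrow> \<bar>h x - h x0\<bar> < \<epsilon> / 4"
    using \<epsilon> unfolding continuous_at_eps_delta dist_real_def by (metis zero_less_divide_iff zero_less_numeral)
  \<comment> \<open>\<open>e / 2\<close> keeps \<open>h x\<close> close to \<open>h x0\<close>,
    \<open>\<epsilon> / 4\<close> limits the concentration loss, \<open>lam s - x0\<close> keeps
    \<open>k\<close> below \<open>lam s * N\<close>, and \<open>1 / 2\<close> keeps \<open>k\<close>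
    positive.\<close>
  define \<delta> where "\<delta> = min (min (e / 2) (\<epsilon> / 4)) (min (lam s - x0) (1 / 2))"
  have "\<delta> > 0" using e \<epsilon> x0 by (simp add: \<delta>_def)
  moreover have "\<delta> \<le> e / 2" unfolding \<delta>_def by (rule min.coboundedI1[OF min.cobounded1])
  moreover have "\<delta> \<le> \<epsilon> / 4" unfolding \<delta>_def by (rule min.coboundedI1[OF min.cobounded2])
  moreover have "\<delta> \<le> lam s - x0" unfolding \<delta>_def by (rule min.coboundedI2[OF min.cobounded1])
  moreover have "\<delta> \<le> 1 / 2" unfolding \<delta>_def by (rule min.coboundedI2[OF min.cobounded2])
  ultimately have \<delta>: "\<delta> > 0" "\<delta> < e" "\<delta> \<le> \<epsilon> / 4" "\<delta> \<le> lam s - x0" "\<delta> \<le> 1 / 2" using e(1) by auto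
  define A where "A = (fps_exp 1 - 1 :: real fps)"
  have A0: "fps_sums A r (exp r - 1)" unfolding A_def by (rule fps_sums_exp_minus_1)
  have E1: "fps_sums (fps_exp 1) r (exp r)" using fps_sums_exp[of 1 r] by simp
  have X: "fps_sums fps_X r r"
    using sums_single[of 1 "\<lambda>_. r"] by (auto simp: fps_sums_def fps_X_nth if_distrib[of "\<lambda>x. x * _"] cong: if_cong)
  have tA: "fps_theta A = fps_X * fps_exp 1" by (simp add: fps_theta_def A_def)
  have A1: "fps_sums (fps_theta A) r (r * exp r)" unfolding tA using r by (intro fps_sums_mult X E1) auto
  have ttA: "fps_theta (fps_theta A) = fps_X * fps_exp 1 + fps_X * (fps_X * fps_exp 1)"
    unfolding tA by (simp add: fps_theta_def algebra_simps)
  have add: "fps_sums (F + G) r (a + b)" if "fps_sums F r a" "fps_sums G r b" for F G a b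
    using that unfolding fps_sums_def by (auto simp: distrib_right intro: sums_add)
  have A2: "fps_sums (fps_theta (fps_theta A)) r (r * exp r + r * (r * exp r))"
    unfolding ttA using r by (intro add fps_sums_mult X E1) auto
  have E0: "exp r - 1 > 0" using r by simp
  have mean: "r * exp r / (exp r - 1) = x0"
    using r E0 unfolding x0_def lam_def by (simp add: exp_minus field_simps)
  have ev: "\<forall>\<^sub>F N in sequentially. \<exists>k. \<bar>real k / real N - x0\<bar> \<le> \<delta> \<and>
     (exp r - 1) ^ N * exp (- \<delta> * real N) \<le> fps_nth (A ^ N) k * r ^ k"
    using fps_power_concentration[OF A0 A1 A2 _ E0 \<delta>(1)] r unfolding mean by simp
  have "((\<lambda>N. exp (- (\<epsilon> / 4) * real N)) \<longlonglongrightarrow> 0)" using \<epsilon> by real_asymp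
  then have ev2: "\<forall>\<^sub>F N in sequentially. exp (- (\<epsilon> / 4) * real N) < exp (- lam s)"
    by (rule order_tendstoD) simp
  show ?thesis using ev ev2 eventually_ge_at_top[of 1]
  proof eventually_elim
    case (elim N)
    have N0: "real N > 0" using elim by simp
    obtain k where k: "\<bar>real k / real N - x0\<bar> \<le> \<delta>" "(exp r - 1) ^ N * exp (- \<delta> * real N) \<le> fps_nth (A ^ N) k * r ^ k"
      using elim(1) by blast
    define x where "x = real k / real N"
    have x: "x > 0" "real k = x * real N" "x \<le> lam s" using k(1) \<delta> x0 N0 by (auto simp: x_def abs_le_iff)
    have "\<bar>h x - h x0\<bar> < \<epsilon> / 4" using k(1) \<delta>(2) unfolding x_def by (intro e(2)) linarith
    then have hx: "h x \<ge> h x0 - \<epsilon> / 4" by linarith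
    have hx0: "h x0 + ln (exp r - 1) = - coupon_rate r"
      using coupon_rate_eq[OF r(1)] by (simp add: h_def x0_def)
    have rate: "coupon_rate r \<le> coupon_rate s + \<epsilon> / 4" using d(2)[OF r(3)] by linarith
    \<comment> \<open>Replacing \<open>N\<close> by \<open>Suc N\<close> in the denominator costs a
      factor bounded below independently of \<open>N\<close>, because
      \<open>k / N \<le> lam s\<close>.\<close>
    have pw: "(real N / real (Suc N)) ^ k \<ge> exp (- lam s)"
    proof -
      have "(1 + 1 / real N) ^ k \<le> exp (1 / real N) ^ k"
        using exp_ge_add_one_self[of "1 / real N"] by (intro power_mono) auto
      also have "\<dots> = exp x" by (simp add: exp_of_nat_mult[symmetric] x_def)
      also have "\<dots> \<le> exp (lam s)" using x by simp
      finally have "inverse (exp (lam s)) \<le> inverse ((1 + 1 / real N) ^ k)" using N0 by (intro le_imp_inverse_le zero_less_power add_pos_nonneg) auto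
      also have "\<dots> = (real N / real (Suc N)) ^ k" using N0 by (simp add: power_inverse[symmetric] field_simps)
      finally show ?thesis by (simp add: exp_minus)
    qed
    have "exp (- real N * (coupon_rate s + \<epsilon>)) = exp (- real N * (coupon_rate s + 3 * \<epsilon> / 4)) * exp (- (\<epsilon> / 4) * real N)"
      by (simp add: exp_add[symmetric] algebra_simps)
    also have "\<dots> \<le> exp (- real N * (coupon_rate s + 3 * \<epsilon> / 4)) * (real N / real (Suc N)) ^ k"
      by (intro mult_left_mono order.trans[OF less_imp_le[OF elim(2)] pw]) simp
    also have "\<dots> \<le> exp (real N * (h x + ln (exp r - 1) - \<delta>)) * (real N / real (Suc N)) ^ k"
    proof (intro mult_right_mono)
      have "- (coupon_rate s + 3 * \<epsilon> / 4) \<le> h x + ln (exp r - 1) - \<delta>" using hx hx0 rate \<delta>(3) by linarith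
      then show "exp (- real N * (coupon_rate s + 3 * \<epsilon> / 4)) \<le> exp (real N * (h x + ln (exp r - 1) - \<delta>))"
        unfolding exp_le_cancel_iff minus_mult_commute by (rule mult_left_mono) simp
    qed auto
    also have "exp (real N * (h x + ln (exp r - 1) - \<delta>)) = x ^ k * exp (- real k) / r ^ k * ((exp r - 1) ^ N * exp (- \<delta> * real N))"
    proof -
      have "(exp r - 1) ^ N = exp (real N * (1 * ln (exp r - 1)))" by (rule power_eq_exp) (use N0 E0 in auto)
      then show ?thesis
        unfolding power_eq_exp[OF x(1) N0 x(2) x(1)] power_eq_exp[OF x(1) N0 x(2) r(1)] x(2) h_def
        by (simp add: exp_add[symmetric] exp_diff[symmetric] algebra_simps)
    qed
    also have "\<dots> * (real N / real (Suc N)) ^ k \<le>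
        x ^ k * exp (- real k) / r ^ k * (fps_nth (A ^ N) k * r ^ k) * (real N / real (Suc N)) ^ k"
      using x r by (intro mult_right_mono mult_left_mono k(2)) auto
    also have "\<dots> = (real k ^ k * exp (- real k)) / real (Suc N) ^ k * fps_nth (A ^ N) k"
      unfolding x(2) power_mult_distrib power_divide using r by (simp add: field_simps)
    also have "\<dots> \<le> fact k / real (Suc N) ^ k * fps_nth (fps_exp (real 1) * A ^ N) k"
    proof (intro mult_mono divide_right_mono fact_ge)
      have AN: "fps_nth (A ^ N) j \<ge> 0" for j using fps_sums_power[OF A0] r unfolding fps_sums_def by simp
      \<comment> \<open>Only the constant coefficient \<open>1\<close> of
        \<open>fps_exp (real 1)\<close> is kept.\<close>
      show "fps_nth (A ^ N) k \<le> fps_nth (fps_exp (real 1) * A ^ N) k"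
        unfolding fps_mult_nth
        by (rule order.trans[OF _ member_le_sum[of 0]]) (auto simp: AN)
      show "0 \<le> fps_nth (A ^ N) k" by (rule AN)
    qed auto
    also have "\<dots> = coupon (Suc N) k 1" using coupon_fps[of "Suc N" 1 k] by (simp add: A_def)
    finally have main: "exp (- real N * (coupon_rate s + \<epsilon>)) \<le> coupon (Suc N) k 1" .
    have kle: "real k \<le> lam s * real N" using x N0 by (simp add: mult_right_mono)
    show ?case
    proof (intro allI impI)
      fix k' assume "lam s * real N \<le> real k'"
      then have "k \<le> k'" using kle by linarith
      then show "exp (- real N * (coupon_rate s + \<epsilon>)) \<le> coupon (Suc N) k' 1"
        using main coupon_mono[of "Suc N" 1 k k'] by simp
    qed
  qed
qed

subsection \<open>Large deviations of the offspring sums\<close>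

definition pgf :: "nat pmf \<Rightarrow> real fps" where
  "pgf \<mu> = Abs_fps (pmf \<mu>)"

text \<open>Convolution of laws is multiplication of generating functions; this puts the sums of
  \<open>K\<close>'s within reach of the lemmas on power series.\<close>

lemma pmf_sum_list_replicate:
  "pmf (map_pmf sum_list (replicate_pmf N \<mu>)) k = fps_nth (pgf \<mu> ^ N) k"
proof (induction N arbitrary: k)
  case 0
  show ?case by (auto simp: fps_one_nth)
next
  case (Suc N)
  let ?P = "map_pmf sum_list (replicate_pmf N \<mu>)"
  have e: "map_pmf sum_list (replicate_pmf (Suc N) \<mu>) = bind_pmf \<mu> (\<lambda>x. map_pmf ((+) x) ?P)"
    by (simp add: map_bind_pmf map_pmf_def bind_assoc_pmf bind_return_pmf)
  have p: "pmf (map_pmf ((+) x) ?P) k = (if x \<le> k then pmf ?P (k - x) else 0)" for x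
  proof (cases "x \<le> k")
    case True
    have "pmf (map_pmf ((+) x) ?P) (x + (k - x)) = pmf ?P (k - x)" by (rule pmf_map_inj') (simp add: inj_def)
    then show ?thesis using True by simp
  next
    case False
    then have "k \<notin> set_pmf (map_pmf ((+) x) ?P)" by auto
    then have "pmf (map_pmf ((+) x) ?P) k = 0" by (rule iffD2[OF pmf_eq_0_set_pmf])
    then show ?thesis using False by (simp only: if_False)
  qed
  have "pmf (map_pmf sum_list (replicate_pmf (Suc N) \<mu>)) k = (\<integral>x. (if x \<le> k then pmf ?P (k - x) else 0) \<partial>\<mu>)"
    unfolding e pmf_bind p ..
  also have "\<dots> = (\<Sum>x\<le>k. (if x \<le> k then pmf ?P (k - x) else 0) * pmf \<mu> x)"
    by (rule integral_measure_pmf_real) (auto split: if_splits)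
  also have "\<dots> = (\<Sum>x\<le>k. pmf \<mu> x * fps_nth (pgf \<mu> ^ N) (k - x))"
    by (intro sum.cong refl) (auto simp: Suc.IH)
  also have "\<dots> = fps_nth (pgf \<mu> ^ Suc N) k" by (simp add: fps_mult_nth pgf_def atLeast0AtMost)
  finally show ?case .
qed

lemma exp_moment_suminf: "exp_moment \<mu> a = (\<Sum>k. ennreal (pmf \<mu> k * exp a ^ k))"
proof -
  have "exp_moment \<mu> a = (\<integral>\<^sup>+ k. ennreal (pmf \<mu> k) * ennreal (exp (a * real k)) \<partial>count_space UNIV)"
    unfolding exp_moment_def by (rule nn_integral_measure_pmf)
  also have "\<dots> = (\<Sum>k. ennreal (pmf \<mu> k) * ennreal (exp (a * real k)))" by (rule nn_integral_count_space_nat)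
  also have "\<dots> = (\<Sum>k. ennreal (pmf \<mu> k * exp a ^ k))"
    by (intro suminf_cong) (simp add: ennreal_mult exp_of_nat_mult[symmetric] mult.commute)
  finally show ?thesis .
qed

lemma exp_moment_sums:
  assumes "exp_moment \<mu> a < \<infinity>"
  shows "fps_sums (pgf \<mu>) (exp a) (enn2real (exp_moment \<mu> a))" "enn2real (exp_moment \<mu> a) > 0"
proof -
  have s: "summable (\<lambda>k. pmf \<mu> k * exp a ^ k)"
    using assms unfolding exp_moment_suminf by (intro summable_suminf_not_top) auto
  have e: "exp_moment \<mu> a = ennreal (\<Sum>k. pmf \<mu> k * exp a ^ k)"
    unfolding exp_moment_suminf by (rule suminf_ennreal_eq) (use s in \<open>auto simp: summable_sums\<close>)
  have "(\<Sum>k. pmf \<mu> k * exp a ^ k) \<ge> 0" by (intro suminf_nonneg s) auto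
  then have e': "enn2real (exp_moment \<mu> a) = (\<Sum>k. pmf \<mu> k * exp a ^ k)" unfolding e by simp
  show "fps_sums (pgf \<mu>) (exp a) (enn2real (exp_moment \<mu> a))"
    unfolding e' fps_sums_def pgf_def using s by (simp add: summable_sums)
  obtain k where k: "k \<in> set_pmf \<mu>" using set_pmf_not_empty[of \<mu>] by blast
  have "0 < (\<Sum>k. pmf \<mu> k * exp a ^ k)"
    by (rule suminf_pos2[OF s, of k]) (use k in \<open>auto simp: pmf_positive\<close>)
  then show "enn2real (exp_moment \<mu> a) > 0" by (simp only: e')
qed

lemma eln_exp_moment:
  assumes "exp_moment \<mu> a < \<infinity>"
  shows "eln (exp_moment \<mu> a) = ereal (ln (enn2real (exp_moment \<mu> a)))"
  using exp_moment_sums(2)[OF assms] assms by (auto simp: eln_def)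

lemma rate_fun_ge:
  assumes "exp_moment \<mu> a < \<infinity>"
  shows "ereal (a * u - ln (enn2real (exp_moment \<mu> a))) \<le> rate_fun \<mu> u"
  unfolding rate_fun_def by (rule SUP_upper2[of a]) (auto simp: eln_exp_moment[OF assms])

lemma rate_fun_nonneg: "0 \<le> rate_fun \<mu> u"
proof -
  have "exp_moment \<mu> 0 = 1" by (simp add: exp_moment_def)
  then show ?thesis using rate_fun_ge[of \<mu> 0 u] by (simp add: zero_ereal_def)
qed

text \<open>Finiteness of the exponential moment at \<open>a\<close> is not known beforehand; a
  bound on the partial sums implies it. This is how limits over truncations return to
  \<open>rate_fun\<close>.\<close>

lemma rate_fun_ge_truncated:
  assumes le: "\<And>m. (\<Sum>k\<le>m. pmf \<mu> k * exp (a * real k)) \<le> c" and c: "c > 0"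
    and I: "rate_fun \<mu> u \<le> ereal \<iota>"
  shows "a * u - ln c \<le> \<iota>"
proof -
  have "exp_moment \<mu> a \<le> ennreal c"
    unfolding exp_moment_suminf
  proof (intro suminf_le_const)
    fix m
    have "(\<Sum>k<m. pmf \<mu> k * exp a ^ k) \<le> (\<Sum>k\<le>m. pmf \<mu> k * exp a ^ k)" by (intro sum_mono2) auto
    also have "\<dots> \<le> c" using le[of m] by (simp add: exp_of_nat_mult[symmetric] mult.commute)
    finally show "(\<Sum>k<m. ennreal (pmf \<mu> k * exp a ^ k)) \<le> ennreal c"
      by (subst sum_ennreal) (auto intro: ennreal_leI)
  qed auto
  then have fin: "exp_moment \<mu> a < \<infinity>" and le: "enn2real (exp_moment \<mu> a) \<le> c"
    using c by (auto simp: enn2real_leI less_le_trans order.strict_trans1)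
  have "ereal (a * u - ln (enn2real (exp_moment \<mu> a))) \<le> ereal \<iota>"
    using rate_fun_ge[OF fin] I by (rule order.trans)
  moreover have "ln (enn2real (exp_moment \<mu> a)) \<le> ln c" using le exp_moment_sums(2)[OF fin] by simp
  ultimately show ?thesis by simp
qed

text \<open>Chernoff's bound for a single atom, for \<open>a\<close> of either sign and without
  error term; where the exponential moment is infinite, the term of the supremum is
  \<open>-\<infinity>\<close>.\<close>

lemma rate_fun_le_sum:
  assumes N: "N \<ge> 1" and p: "fps_nth (pgf \<mu> ^ N) k > 0"
  shows "rate_fun \<mu> (real k / real N) \<le> ereal (- ln (fps_nth (pgf \<mu> ^ N) k) / real N)"
  unfolding rate_fun_def
proof (rule SUP_least)
  fix a :: real
  let ?p = "fps_nth (pgf \<mu> ^ N) k"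
  show "ereal (a * (real k / real N)) - eln (exp_moment \<mu> a) \<le> ereal (- ln ?p / real N)"
  proof (cases "exp_moment \<mu> a < \<infinity>")
    case True
    let ?f = "enn2real (exp_moment \<mu> a)"
    have f: "?f > 0" by (rule exp_moment_sums(2)[OF True])
    have "?p * exp a ^ k \<le> ?f ^ N"
      by (intro fps_sums_nth_le fps_sums_power exp_moment_sums(1)[OF True]) auto
    then have "ln (?p * exp a ^ k) \<le> ln (?f ^ N)" using p f by (subst ln_le_cancel_iff) auto
    then have "ln ?p + real k * a \<le> real N * ln ?f" using p f by (simp add: ln_mult ln_realpow)
    then have "(ln ?p + real k * a) / real N \<le> ln ?f" using N by (subst pos_divide_le_eq) (simp_all add: mult.commute)
    then have "a * (real k / real N) - ln ?f \<le> - ln ?p / real N" by (simp add: add_divide_distrib mult.commute)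
    then show ?thesis by (simp add: eln_exp_moment[OF True])
  next
    case False
    then have "exp_moment \<mu> a = \<top>" by (metis infinity_ennreal_def top.not_eq_extremum)
    then show ?thesis by (simp add: eln_def)
  qed
qed

lemma nn_integral_exp_sum_list:
  "(\<integral>\<^sup>+ ks. ennreal (exp (a * real (sum_list ks))) \<partial>replicate_pmf N \<mu>) = exp_moment \<mu> a ^ N"
proof (induction N)
  case (Suc N)
  have "(\<integral>\<^sup>+ ks. ennreal (exp (a * real (sum_list ks))) \<partial>replicate_pmf (Suc N) \<mu>) =
     (\<integral>\<^sup>+ k. \<integral>\<^sup>+ ks. ennreal (exp (a * real k)) * ennreal (exp (a * real (sum_list ks))) \<partial>replicate_pmf N \<mu> \<partial>\<mu>)"
    by (simp add: ennreal_mult[symmetric] exp_add[symmetric] distrib_left)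
  also have "\<dots> = exp_moment \<mu> a * exp_moment \<mu> a ^ N"
    by (simp add: nn_integral_cmult nn_integral_multc Suc.IH exp_moment_def)
  finally show ?case by simp
qed simp

text \<open>Markov's inequality; it serves for totals so large that the exact rate does not
  matter.\<close>

lemma prob_sum_list_ge_le:
  assumes a: "a > 0" and fin: "exp_moment \<mu> a < \<infinity>"
  shows "measure (replicate_pmf N \<mu>) {ks. x \<le> real (sum_list ks)}
    \<le> exp (- a * x) * enn2real (exp_moment \<mu> a) ^ N"
proof -
  let ?R = "replicate_pmf N \<mu>"
  have "emeasure ?R {ks. x \<le> real (sum_list ks)} = (\<integral>\<^sup>+ ks. indicator {ks. x \<le> real (sum_list ks)} ks \<partial>?R)"
    by simp
  also have "\<dots> \<le> (\<integral>\<^sup>+ ks. ennreal (exp (- a * x)) * ennreal (exp (a * real (sum_list ks))) \<partial>?R)"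
  proof (intro nn_integral_mono)
    fix ks
    show "indicator {ks. x \<le> real (sum_list ks)} ks \<le> ennreal (exp (- a * x)) * ennreal (exp (a * real (sum_list ks)))"
    proof (cases "x \<le> real (sum_list ks)")
      case True
      then have "1 \<le> exp (- a * x) * exp (a * real (sum_list ks))"
        using a by (simp add: exp_add[symmetric])
      then have "1 \<le> ennreal (exp (- a * x) * exp (a * real (sum_list ks)))" using ennreal_leI by fastforce
      then show ?thesis using True by (simp add: ennreal_mult)
    qed simp
  qed
  also have "\<dots> = ennreal (exp (- a * x)) * exp_moment \<mu> a ^ N"
    by (simp add: nn_integral_cmult nn_integral_exp_sum_list)
  also have "\<dots> = ennreal (exp (- a * x) * enn2real (exp_moment \<mu> a) ^ N)"
    using fin by (simp add: ennreal_mult ennreal_power[symmetric])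
  finally show ?thesis by (simp add: measure_pmf.emeasure_eq_measure)
qed

lemma prob_sum_list_ge_nth:
  assumes "x \<le> real k"
  shows "fps_nth (pgf \<mu> ^ N) k \<le> measure (replicate_pmf N \<mu>) {ks. x \<le> real (sum_list ks)}"
proof -
  have "fps_nth (pgf \<mu> ^ N) k = measure (map_pmf sum_list (replicate_pmf N \<mu>)) {k}"
    by (simp only: pmf_sum_list_replicate[symmetric] measure_pmf_single)
  also have "\<dots> \<le> measure (replicate_pmf N \<mu>) {ks. x \<le> real (sum_list ks)}"
    unfolding measure_map_pmf using assms by (intro measure_pmf.finite_measure_mono) auto
  finally show ?thesis .
qed

lemma fps_power_mono:
  fixes A B :: "real fps"
  assumes "\<And>k. 0 \<le> fps_nth A k" "\<And>k. fps_nth A k \<le> fps_nth B k"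
  shows "0 \<le> fps_nth (A ^ N) k \<and> fps_nth (A ^ N) k \<le> fps_nth (B ^ N) k"
proof (induction N arbitrary: k)
  case (Suc N)
  have "fps_nth A i * fps_nth (A ^ N) (k - i) \<le> fps_nth B i * fps_nth (B ^ N) (k - i)" for i
    using assms Suc.IH[of "k - i"] order.trans[OF assms(1)[of i] assms(2)[of i]] by (intro mult_mono) auto
  then show ?case using assms Suc.IH by (auto simp: fps_mult_nth intro!: sum_mono sum_nonneg)
qed (auto simp: fps_one_nth)

text \<open>Letting \<open>a\<close> tend to infinity in the Legendre transform shows that \<open>u\<close> is an atom of \<open>\<mu>\<close>.\<close>

lemma prob_sum_list_ge_extreme:
  assumes u: "u \<ge> 1" and I: "rate_fun \<mu> u \<le> ereal \<iota>" and top: "\<And>k. u < real k \<Longrightarrow> pmf \<mu> k = 0"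
  shows "exp (- real N * \<iota>) \<le> measure (replicate_pmf N \<mu>) {ks. u * real N \<le> real (sum_list ks)}"
proof -
  define k0 where "k0 = nat \<lfloor>u\<rfloor>"
  have k0: "real k0 \<le> u" "u < real k0 + 1" "k0 \<ge> 1" using u unfolding k0_def by linarith+
  have z: "pmf \<mu> k = 0" if "k > k0" for k
  proof (rule top)
    have "real k \<ge> real k0 + 1" using that by linarith
    then show "u < real k" using k0 by linarith
  qed
  \<comment> \<open>Atoms below \<open>k0\<close> contribute at most \<open>exp (- a)\<close>
    relative to \<open>exp (a * real k0)\<close>, and there are none above.\<close>
  have key: "exp (a * (u - real k0) - \<iota>) \<le> pmf \<mu> k0 + exp (- a)" if a: "a \<ge> 0" for a
  proof -
    define c where "c = (pmf \<mu> k0 + exp (- a)) * exp (a * real k0)"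
    have c: "c > 0" by (simp add: c_def add_nonneg_pos)
    have "(\<Sum>k\<le>m. pmf \<mu> k * exp (a * real k)) \<le> c" for m
    proof -
      have "(\<Sum>k\<le>m. pmf \<mu> k * exp (a * real k)) \<le>
        (\<Sum>k\<le>m. (if k = k0 then pmf \<mu> k0 * exp (a * real k0) else 0) + pmf \<mu> k * (exp (- a) * exp (a * real k0)))"
      proof (intro sum_mono)
        fix k
        show "pmf \<mu> k * exp (a * real k) \<le> (if k = k0 then pmf \<mu> k0 * exp (a * real k0) else 0) + pmf \<mu> k * (exp (- a) * exp (a * real k0))"
        proof (cases "k < k0")
          case True
          then have "a * real k \<le> - a + a * real k0" using a mult_left_mono[of "real k + 1" "real k0" a] by (simp add: algebra_simps)
          then have "pmf \<mu> k * exp (a * real k) \<le> pmf \<mu> k * exp (- a + a * real k0)" by (intro mult_left_mono) auto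
          then show ?thesis using True unfolding exp_add by simp
        next
          case False
          then show ?thesis using z[of k] by auto
        qed
      qed
      also have "\<dots> \<le> pmf \<mu> k0 * exp (a * real k0) + 1 * (exp (- a) * exp (a * real k0))"
        unfolding sum.distrib sum_distrib_right[symmetric]
      proof (intro add_mono mult_right_mono)
        show "(\<Sum>k\<le>m. pmf \<mu> k) \<le> 1" by (simp add: measure_measure_pmf_finite[symmetric])
      qed (auto simp: sum.delta)
      finally show ?thesis by (simp add: c_def algebra_simps)
    qed
    from rate_fun_ge_truncated[OF this c I] have "a * u - ln c \<le> \<iota>" .
    moreover have pos: "pmf \<mu> k0 + exp (- a) > 0" by (simp add: add_nonneg_pos)
    moreover have "ln c = ln (pmf \<mu> k0 + exp (- a)) + a * real k0" unfolding c_def using pos by (subst ln_mult) auto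
    ultimately have "a * (u - real k0) - \<iota> \<le> ln (pmf \<mu> k0 + exp (- a))" by (simp add: algebra_simps)
    then have "exp (a * (u - real k0) - \<iota>) \<le> exp (ln (pmf \<mu> k0 + exp (- a)))" by simp
    then show ?thesis using pos by (simp only: exp_ln)
  qed
  have uk: "u = real k0"
  proof (rule ccontr)
    assume "u \<noteq> real k0"
    then have d: "u - real k0 > 0" using k0 by simp
    \<comment> \<open>Makes the left-hand side of \<open>key\<close> at least \<open>exp 2\<close>,
      while its right-hand side is at most \<open>2\<close>.\<close>
    define a where "a = (\<bar>\<iota>\<bar> + 2) / (u - real k0)"
    have a: "a \<ge> 0" "a * (u - real k0) = \<bar>\<iota>\<bar> + 2" using d by (auto simp: a_def)
    have "1 + 2 \<le> exp (2 :: real)" by (rule exp_ge_add_one_self[of 2, simplified add.commute])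
    also have "exp 2 \<le> exp (a * (u - real k0) - \<iota>)" using a by simp
    also have "\<dots> \<le> pmf \<mu> k0 + exp (- a)" by (rule key[OF a(1)])
    also have "\<dots> \<le> 1 + 1" using a(1) by (intro add_mono) (auto simp: pmf_le_1)
    finally show False by simp
  qed
  have "(\<lambda>n. pmf \<mu> k0 + exp (- real n)) \<longlonglongrightarrow> pmf \<mu> k0 + 0"
    by (intro tendsto_add tendsto_const) real_asymp
  then have "exp (- \<iota>) \<le> pmf \<mu> k0 + 0"
    by (rule LIMSEQ_le_const) (use key in \<open>auto simp: uk\<close>)
  then have p: "exp (- \<iota>) \<le> pmf \<mu> k0" by simp
  \<comment> \<open>The event that all \<open>N\<close> variables equal \<open>k0\<close>.\<close>
  have "pmf \<mu> k0 ^ N \<le> fps_nth (pgf \<mu> ^ N) (k0 * N)"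
  proof (induction N)
    case (Suc N)
    have nn: "fps_nth (pgf \<mu> ^ N) j \<ge> 0" for j by (simp add: pmf_sum_list_replicate[symmetric])
    have nn0: "fps_nth (pgf \<mu>) i \<ge> 0" for i by (simp add: pgf_def)
    have "pmf \<mu> k0 ^ Suc N \<le> fps_nth (pgf \<mu>) k0 * fps_nth (pgf \<mu> ^ N) (k0 * N)"
      using Suc by (simp add: pgf_def mult_left_mono)
    also have "\<dots> = fps_nth (pgf \<mu>) k0 * fps_nth (pgf \<mu> ^ N) (k0 * Suc N - k0)" by simp
    also have "\<dots> \<le> (\<Sum>i=0..k0 * Suc N. fps_nth (pgf \<mu>) i * fps_nth (pgf \<mu> ^ N) (k0 * Suc N - i))"
      by (rule member_le_sum) (auto simp: nn nn0)
    finally show ?case by (simp only: power_Suc fps_mult_nth)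
  qed simp
  moreover have "exp (- real N * \<iota>) = exp (- \<iota>) ^ N" by (simp add: exp_of_nat_mult[symmetric])
  moreover have "exp (- \<iota>) ^ N \<le> pmf \<mu> k0 ^ N" using p by (intro power_mono) auto
  ultimately show ?thesis using prob_sum_list_ge_nth[of "u * real N" "k0 * N" \<mu> N] uk by simp
qed

text \<open>Truncating \<open>\<mu>\<close> makes all exponential
  moments finite, so that the optimal tilt exists; Legendre transforms of truncations converge by
  compactness. The target is moved up from \<open>u\<close> to \<open>u1\<close> to leave room for the fluctuations of the tilted
  sums, which costs little by convexity.\<close>

lemma prob_sum_list_ge_interior:
  assumes I: "rate_fun \<mu> u \<le> ereal \<iota>" and k1: "u < real k1" "pmf \<mu> k1 > 0" and \<epsilon>: "\<epsilon> > 0"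
  shows "\<forall>\<^sub>F N in sequentially. exp (- real N * (\<iota> + \<epsilon>)) \<le> measure (replicate_pmf N \<mu>) {ks. u * real N \<le> real (sum_list ks)}"
proof -
  define L where "L = - ln (pmf \<mu> k1)"
  have L0: "L \<ge> 0" using k1 pmf_le_1[of \<mu> k1] by (simp add: L_def)
  have \<iota>0: "\<iota> \<ge> 0" using order.trans[OF rate_fun_nonneg I] by simp
  \<comment> \<open>Small enough that replacing \<open>u\<close> by the mixture \<open>u1\<close> of
    \<open>u\<close> and \<open>k1\<close> costs at most \<open>\<epsilon> / 2\<close>.\<close>
  define \<theta> where "\<theta> = min (1 / 2) (\<epsilon> / (2 * (L + \<iota> + 1)))"
  have \<theta>: "0 < \<theta>" "\<theta> < 1" using \<epsilon> L0 \<iota>0 by (auto simp: \<theta>_def)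
  have "\<theta> \<le> \<epsilon> / (2 * (L + \<iota> + 1))" by (simp add: \<theta>_def)
  then have "\<theta> * (L + \<iota> + 1) \<le> \<epsilon> / 2" using L0 \<iota>0 by (simp add: field_simps)
  moreover have "\<theta> * L \<le> \<theta> * (L + \<iota> + 1)" using \<theta> \<iota>0 by (intro mult_left_mono) auto
  moreover have "(1 - \<theta>) * \<iota> \<le> 1 * \<iota>" using \<theta> \<iota>0 by (intro mult_right_mono) auto
  ultimately have mix: "(1 - \<theta>) * \<iota> + \<theta> * L \<le> \<iota> + \<epsilon> / 2" by simp
  define u1 where "u1 = (1 - \<theta>) * u + \<theta> * real k1"
  have u1_eq: "u1 - u = \<theta> * (real k1 - u)" "real k1 - u1 = (1 - \<theta>) * (real k1 - u)"
    by (simp_all add: u1_def algebra_simps)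
  have u1: "u < u1" "u1 < real k1"
    using u1_eq \<theta> k1(1) by (metis diff_gt_0_iff_gt zero_less_mult_iff)+
  \<comment> \<open>Exponential moment truncated at \<open>m\<close>. The atom \<open>k1\<close>
    bounds its logarithm below by a line of slope \<open>k1 > u1\<close>, which confines the
    maximisation over \<open>a\<close> to \<open>[0, B]\<close>.\<close>
  define \<phi> where "\<phi> m a = (\<Sum>k\<le>m. pmf \<mu> k * exp (a * real k))" for m a
  have \<phi>_mono: "\<phi> m a \<le> \<phi> m' a" if "m \<le> m'" for m m' a
    unfolding \<phi>_def using that by (intro sum_mono2) auto
  have \<phi>_ge: "pmf \<mu> k1 * exp (a * real k1) \<le> \<phi> m a" if "k1 \<le> m" for m a
    unfolding \<phi>_def using that by (intro member_le_sum) auto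
  have \<phi>_pos: "\<phi> m a > 0" if "k1 \<le> m" for m a
    using \<phi>_ge[OF that, of a] k1(2) by (meson exp_gt_zero less_le_trans mult_pos_pos)
  have ln\<phi>: "a * real k1 - L \<le> ln (\<phi> m a)" if "k1 \<le> m" for m a
  proof -
    have "ln (pmf \<mu> k1 * exp (a * real k1)) \<le> ln (\<phi> m a)"
      using \<phi>_ge[OF that, of a] \<phi>_pos[OF that, of a] k1(2) by simp
    then show ?thesis using k1(2) by (simp add: ln_mult L_def)
  qed
  have cont: "continuous_on X (\<lambda>a. a * u1 - ln (\<phi> m a))" if "k1 \<le> m" for m X
    using \<phi>_pos[OF that] unfolding \<phi>_def by (intro continuous_intros) (auto simp: less_imp_neq[symmetric] intro: less_imp_neq)
  define B where "B = L / (real k1 - u1)"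
  have B: "a * u1 - ln (\<phi> m a) \<le> 0" if "k1 \<le> m" "a \<ge> B" for m a
  proof -
    have "L \<le> a * (real k1 - u1)" using that(2) u1 by (simp add: B_def field_simps)
    then show ?thesis using ln\<phi>[OF that(1), of a] by (simp add: algebra_simps)
  qed
  have B0: "B \<ge> 0" using L0 u1 by (simp add: B_def)
  define c0 where "c0 = \<iota> + 3 * \<epsilon> / 4"
  have c0: "c0 > 0" using \<iota>0 \<epsilon> by (simp add: c0_def)
  \<comment> \<open>If every truncation failed, nested compact sets of bad \<open>a\<close> would
    share a point; there the bounds at \<open>u\<close> and at \<open>k1\<close>, mixed with weight
    \<open>\<theta>\<close>, contradict the choice of \<open>c0\<close>.\<close>
  have ex: "\<exists>m\<ge>k1. \<forall>a\<ge>0. a * u1 - ln (\<phi> m a) < c0"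
  proof (rule ccontr)
    assume "\<not> ?thesis"
    then have no: "\<exists>a\<ge>0. c0 \<le> a * u1 - ln (\<phi> m a)" if "k1 \<le> m" for m using that by (meson not_less)
    define C where "C j = {0..B} \<inter> (\<lambda>a. a * u1 - ln (\<phi> (k1 + j) a)) -` {c0..}" for j
    have "\<Inter>(range C) \<noteq> {}"
    proof (rule compact_nest)
      fix j
      have "closed (C j)" unfolding C_def by (intro continuous_closed_preimage cont) auto
      then have "compact ({0..B} \<inter> C j)" by (intro compact_Int_closed) auto
      then show "compact (C j)" by (simp add: C_def Int_absorb1)
      obtain a where a: "a \<ge> 0" "c0 \<le> a * u1 - ln (\<phi> (k1 + j) a)" using no[of "k1 + j"] by auto
      then have "a \<le> B" using B[of "k1 + j" a] c0 by (meson le_add1 linorder_not_le less_imp_le order.strict_trans2)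
      then show "C j \<noteq> {}" using a by (auto simp: C_def)
    next
      fix i j :: nat assume ij: "i \<le> j"
      show "C j \<subseteq> C i"
      proof
        fix a assume a: "a \<in> C j"
        have "ln (\<phi> (k1 + i) a) \<le> ln (\<phi> (k1 + j) a)"
          using \<phi>_mono[of "k1 + i" "k1 + j" a] \<phi>_pos[of "k1 + i" a] ij by simp
        then show "a \<in> C i" using a unfolding C_def by simp
      qed
    qed
    then obtain a where a: "\<And>j. a \<in> C j" by blast
    define c where "c = exp (a * u1 - c0)"
    have le: "\<phi> m a \<le> c" for m
    proof -
      have "ln (\<phi> (k1 + m) a) \<le> a * u1 - c0" using a[of m] by (simp add: C_def)
      then have "\<phi> (k1 + m) a \<le> c" unfolding c_def using \<phi>_pos[of "k1 + m" a] by (metis exp_le_cancel_iff exp_ln le_add1)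
      then show ?thesis using \<phi>_mono[of m "k1 + m" a] by simp
    qed
    have cpos: "c > 0" by (simp add: c_def)
    have 1: "a * u - ln c \<le> \<iota>" by (rule rate_fun_ge_truncated[OF le[unfolded \<phi>_def] cpos I])
    have "ln (\<phi> k1 a) \<le> ln c" using le[of k1] \<phi>_pos[of k1 a] cpos by simp
    then have 2: "a * real k1 - ln c \<le> L" using ln\<phi>[of k1 a] by simp
    have "c0 = a * u1 - ln c" by (simp add: c_def)
    also have "\<dots> = (1 - \<theta>) * (a * u - ln c) + \<theta> * (a * real k1 - ln c)" by (simp add: u1_def algebra_simps)
    also have "\<dots> \<le> (1 - \<theta>) * \<iota> + \<theta> * L" using 1 2 \<theta> by (intro add_mono mult_left_mono) auto
    finally show False using mix \<epsilon> by (simp add: c0_def)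
  qed
  then obtain m where m: "k1 \<le> m" "\<And>a. a \<ge> 0 \<Longrightarrow> a * u1 - ln (\<phi> m a) < c0" by blast
  define g where "g a = a * u1 - ln (\<phi> m a)" for a
  obtain b where b: "b \<in> {0..B}" "\<And>a. a \<in> {0..B} \<Longrightarrow> g a \<le> g b"
    using continuous_attains_sup[of "{0..B}" g] cont[OF m(1), of "{0..B}"] B0 unfolding g_def by auto
  have "\<phi> m 0 \<le> 1" unfolding \<phi>_def by (simp add: measure_measure_pmf_finite[symmetric])
  then have "g 0 \<ge> 0" using \<phi>_pos[OF m(1), of 0] by (simp add: g_def)
  then have "g b \<ge> 0" using b(2)[of 0] B0 by simp
  then have gmax: "g a \<le> g b" if "a \<ge> 0" for a
    using b(2)[of a] B[OF m(1), of a] that unfolding g_def by (cases "a \<le> B") auto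
  define \<phi>1 where "\<phi>1 = (\<Sum>k\<le>m. real k * (pmf \<mu> k * exp b ^ k))"
  define v where "v = \<phi>1 / \<phi> m b"
  have eb: "exp b ^ k = exp (b * real k)" for k by (simp add: exp_of_nat_mult[symmetric] mult.commute)
  have dg: "(g has_real_derivative (u1 - v)) (at b)"
  proof -
    have "((\<lambda>a. \<phi> m a) has_real_derivative \<phi>1) (at b)"
      unfolding \<phi>_def \<phi>1_def eb by (auto intro!: derivative_eq_intros sum.cong simp: mult_ac)
    then show ?thesis unfolding g_def v_def using \<phi>_pos[OF m(1), of b]
      by (auto intro!: derivative_eq_intros)
  qed
  \<comment> \<open>First-order conditions at the maximiser over \<open>a \<ge> 0\<close>: the
    tilted mean \<open>v\<close> equals \<open>u1\<close> if \<open>b > 0\<close> and is at least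
    \<open>u1\<close> if \<open>b = 0\<close>, in which case there is no tilt to pay for.\<close>
  have v1: "u1 \<le> v"
  proof (rule ccontr)
    assume "\<not> u1 \<le> v"
    then obtain d where d: "d > 0" "\<And>h. 0 < h \<Longrightarrow> h < d \<Longrightarrow> g b < g (b + h)"
      using DERIV_pos_inc_right[OF dg] by auto
    show False using d(2)[of "d / 2"] d(1) gmax[of "b + d / 2"] b(1) by simp
  qed
  have v2: "b * v = b * u1"
  proof (cases "b = 0")
    case False
    then have bp: "b > 0" using b(1) by simp
    have "\<not> u1 < v"
    proof
      assume "u1 < v"
      then obtain d where d: "d > 0" "\<And>h. 0 < h \<Longrightarrow> h < d \<Longrightarrow> g b < g (b - h)"
        using DERIV_neg_dec_left[OF dg] by auto
      have "min (d / 2) b < d" "0 < min (d / 2) b" "0 \<le> b - min (d / 2) b" using d(1) bp by (auto simp: min_def)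
      then show False using d(2)[of "min (d / 2) b"] gmax[of "b - min (d / 2) b"] by linarith
    qed
    then show ?thesis using v1 by simp
  qed simp
  define A where "A = Abs_fps (\<lambda>k. if k \<le> m then pmf \<mu> k else 0)"
  have fin: "fps_sums F (exp b) (\<Sum>k\<le>m. w k * (pmf \<mu> k * exp b ^ k))"
    if "\<And>k. fps_nth F k = w k * fps_nth A k" "\<And>k. w k \<ge> 0" for F w
  proof -
    have "(\<lambda>k. fps_nth F k * exp b ^ k) sums (\<Sum>k\<le>m. fps_nth F k * exp b ^ k)"
      by (rule sums_finite) (auto simp: that A_def)
    moreover have "(\<Sum>k\<le>m. fps_nth F k * exp b ^ k) = (\<Sum>k\<le>m. w k * (pmf \<mu> k * exp b ^ k))"
      by (intro sum.cong) (auto simp: that A_def)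
    ultimately show ?thesis using that by (simp add: fps_sums_def A_def)
  qed
  have A0: "fps_sums A (exp b) (\<phi> m b)" using fin[of A "\<lambda>_. 1"] by (simp add: \<phi>_def eb)
  have A1: "fps_sums (fps_theta A) (exp b) \<phi>1" using fin[of "fps_theta A" real] by (simp add: \<phi>1_def fps_theta_nth)
  have A2: "fps_sums (fps_theta (fps_theta A)) (exp b) (\<Sum>k\<le>m. (real k * real k) * (pmf \<mu> k * exp b ^ k))"
    by (rule fin) (auto simp: fps_theta_nth)
  \<comment> \<open>The first bound keeps \<open>k\<close> above \<open>u * real N\<close>; the
    second pays for the concentration loss and for the displacement of \<open>k\<close> in
    \<open>exp b ^ k\<close>.\<close>
  define \<delta> where "\<delta> = min (u1 - u) (\<epsilon> / (4 * (1 + b)))"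
  have \<delta>0: "\<delta> > 0" using u1 \<epsilon> b(1) by (simp add: \<delta>_def)
  have "\<delta> \<le> u1 - u" by (simp add: \<delta>_def)
  moreover have "\<delta> \<le> \<epsilon> / (4 * (1 + b))" by (simp add: \<delta>_def)
  ultimately have \<delta>: "\<delta> \<le> u1 - u" "\<delta> * (1 + b) \<le> \<epsilon> / 4" using b(1) by (simp_all add: field_simps)
  have "\<forall>\<^sub>F N in sequentially. \<exists>k. \<bar>real k / real N - v\<bar> \<le> \<delta> \<and>
    \<phi> m b ^ N * exp (- \<delta> * real N) \<le> fps_nth (A ^ N) k * exp b ^ k"
    unfolding v_def by (rule fps_power_concentration[OF A0 A1 A2 _ \<phi>_pos[OF m(1)] \<delta>0]) simp
  then show ?thesis using eventually_ge_at_top[of 1]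
  proof eventually_elim
    case (elim N)
    have N0: "real N > 0" using elim by simp
    obtain k where k: "\<bar>real k / real N - v\<bar> \<le> \<delta>" "\<phi> m b ^ N * exp (- \<delta> * real N) \<le> fps_nth (A ^ N) k * exp b ^ k"
      using elim by blast
    have "u \<le> real k / real N" using k(1) v1 \<delta>(1) by linarith
    then have ku: "u * real N \<le> real k" using N0 by (simp add: field_simps)
    have "real k / real N \<le> v + \<delta>" using k(1) by linarith
    then have "b * (real k / real N) \<le> b * (v + \<delta>)" using b(1) by (intro mult_left_mono) auto
    then have kb: "b * real k \<le> real N * (b * u1 + b * \<delta>)" using N0 v2 by (simp add: field_simps)
    have "exp (- real N * (\<iota> + \<epsilon>)) \<le> exp (real N * (ln (\<phi> m b) - b * u1 - \<delta> * (1 + b)))"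
    proof -
      have "- (\<iota> + \<epsilon>) \<le> ln (\<phi> m b) - b * u1 - \<delta> * (1 + b)"
        using m(2)[of b] b(1) \<delta>(2) unfolding c0_def by auto
      then show ?thesis unfolding exp_le_cancel_iff minus_mult_commute by (rule mult_left_mono) simp
    qed
    also have "\<dots> \<le> exp (real N * ln (\<phi> m b) - \<delta> * real N - b * real k)"
      using kb by (simp add: algebra_simps)
    also have "\<dots> = \<phi> m b ^ N * exp (- \<delta> * real N) / exp b ^ k"
    proof -
      have "exp (real N * ln (\<phi> m b)) = \<phi> m b ^ N" using \<phi>_pos[OF m(1), of b] by (simp add: exp_of_nat_mult)
      then show ?thesis by (simp add: exp_diff exp_minus eb divide_inverse)
    qed
    also have "\<dots> \<le> fps_nth (A ^ N) k" using k(2) by (simp add: field_simps)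
    also have "\<dots> \<le> fps_nth (pgf \<mu> ^ N) k" using fps_power_mono[of A "pgf \<mu>" N k] by (simp add: A_def pgf_def)
    also have "\<dots> \<le> measure (replicate_pmf N \<mu>) {ks. u * real N \<le> real (sum_list ks)}"
      by (rule prob_sum_list_ge_nth[OF ku])
    finally show ?case .
  qed
qed

text \<open>An atom above \<open>u\<close> leaves room for a tilted mean above \<open>u\<close>;
  without one, finiteness of the rate forces \<open>u\<close> to be the top atom.\<close>

lemma prob_sum_list_ge:
  assumes u: "u \<ge> 1" and I: "rate_fun \<mu> u \<le> ereal \<iota>" and \<epsilon>: "\<epsilon> > 0"
  shows "\<forall>\<^sub>F N in sequentially. exp (- real N * (\<iota> + \<epsilon>)) \<le> measure (replicate_pmf N \<mu>) {ks. u * real N \<le> real (sum_list ks)}"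
proof (cases "\<exists>k. u < real k \<and> pmf \<mu> k > 0")
  case True
  then show ?thesis using prob_sum_list_ge_interior[OF I _ _ \<epsilon>] by blast
next
  case False
  then have top: "pmf \<mu> k = 0" if "u < real k" for k using that by (metis pmf_nonneg less_eq_real_def)
  show ?thesis
  proof (intro always_eventually allI)
    fix N
    have "exp (- real N * (\<iota> + \<epsilon>)) \<le> exp (- real N * \<iota>)" using \<epsilon> by (simp add: mult_left_mono)
    also have "\<dots> \<le> measure (replicate_pmf N \<mu>) {ks. u * real N \<le> real (sum_list ks)}"
      by (rule prob_sum_list_ge_extreme[OF u I top])
    finally show "exp (- real N * (\<iota> + \<epsilon>)) \<le> measure (replicate_pmf N \<mu>) {ks. u * real N \<le> real (sum_list ks)}" .
  qed
qed

subsection \<open>The decay rate\<close>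

lemma trans_rate_eq:
  "trans_rate \<mu> = (INF s\<in>{0::real..}. rate_fun \<mu> (lam s) + ereal (coupon_rate s))"
  by (simp add: trans_rate_def coupon_rate_def)

text \<open>Large \<open>s\<close> is handled by the exponential moment through
  \<open>lam s \<ge> s\<close>, smaller \<open>s\<close> by \<open>coupon_rate_pos\<close>;
  \<open>s0\<close> is where the linear bound \<open>a * s - ln ?f\<close> reaches
  \<open>1\<close>.\<close>

lemma trans_rate_pos:
  assumes a: "a > 0" and fin: "exp_moment \<mu> a < \<infinity>"
  shows "trans_rate \<mu> > 0"
proof -
  let ?f = "enn2real (exp_moment \<mu> a)"
  define s0 where "s0 = (1 + ln ?f) / a"
  define c where "c = min 1 (exp (- 2 * s0) / 2)"
  have "ereal c \<le> rate_fun \<mu> (lam s) + ereal (coupon_rate s)" if s: "s \<ge> 0" for s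
  proof (cases "s \<ge> s0")
    case True
    then have "1 + ln ?f \<le> a * s" using a by (simp add: s0_def field_simps)
    also have "a * s \<le> a * lam s" using a lam_ge(2)[OF s] by (intro mult_left_mono) auto
    finally have "c \<le> a * lam s - ln ?f" by (simp add: c_def)
    then have "ereal c \<le> ereal (a * lam s - ln ?f)" by simp
    also have "\<dots> \<le> rate_fun \<mu> (lam s)" by (rule rate_fun_ge[OF fin])
    also have "\<dots> \<le> rate_fun \<mu> (lam s) + ereal (coupon_rate s)"
      using coupon_rate_pos[OF s] by (intro ereal_le_add_self) (simp add: order.trans[OF _ coupon_rate_pos[OF s]])
    finally show ?thesis .
  next
    case False
    then have "exp (- 2 * s0) \<le> exp (- 2 * s)" by simp
    moreover have "c \<le> exp (- 2 * s0) / 2" by (simp only: c_def min.cobounded2)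
    ultimately have "c \<le> exp (- 2 * s) / 2" by linarith
    also have "\<dots> \<le> coupon_rate s" by (rule coupon_rate_pos[OF s])
    finally have "ereal c \<le> ereal (coupon_rate s)" by simp
    also have "\<dots> \<le> rate_fun \<mu> (lam s) + ereal (coupon_rate s)"
      using rate_fun_nonneg by (intro ereal_le_add_self2) auto
    finally show ?thesis .
  qed
  then have "ereal c \<le> trans_rate \<mu>" unfolding trans_rate_eq by (intro INF_greatest) auto
  moreover have "0 < ereal c" by (simp add: c_def)
  ultimately show ?thesis by (rule less_le_trans[rotated])
qed

text \<open>An atom \<open>k \<ge> 1\<close> of \<open>\<mu>\<close> is a value of
  \<open>lam\<close>, and the atom bound with \<open>N = 1\<close> gives
  \<open>rate_fun \<mu> k \<le> - ln (pmf \<mu> k)\<close>.\<close>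

lemma trans_rate_finite:
  assumes "pmf \<mu> 0 < 1"
  shows "trans_rate \<mu> < \<infinity>"
proof -
  have "\<exists>k\<in>set_pmf \<mu>. k \<noteq> 0"
  proof (rule ccontr)
    assume "\<not> ?thesis"
    then have "set_pmf \<mu> \<subseteq> {0}" by auto
    then have "\<mu> = return_pmf 0" by (simp add: set_pmf_subset_singleton)
    then show False using assms by simp
  qed
  then obtain k where k: "k \<noteq> 0" "pmf \<mu> k > 0" by (auto simp: pmf_positive_iff)
  obtain s where s: "0 \<le> s" "lam s = real k" using lam_surj[of "real k"] k(1) by auto
  have "rate_fun \<mu> (real k) \<le> ereal (- ln (pmf \<mu> k))"
    using rate_fun_le_sum[of 1 \<mu> k] k(2) by (simp add: pgf_def)
  then have "rate_fun \<mu> (lam s) + ereal (coupon_rate s) \<le> ereal (- ln (pmf \<mu> k) + coupon_rate s)"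
    unfolding s(2) plus_ereal.simps(1)[symmetric] by (rule add_right_mono)
  moreover have "trans_rate \<mu> \<le> rate_fun \<mu> (lam s) + ereal (coupon_rate s)"
    unfolding trans_rate_eq using s(1) by (intro INF_lower) simp
  ultimately have "trans_rate \<mu> \<le> ereal (- ln (pmf \<mu> k) + coupon_rate s)" by (rule order.trans[rotated])
  then show ?thesis by (rule order.strict_trans1) simp
qed

section \<open>Exponential upper and lower bounds for the probability of
  \<open>Trans\<close>\<close>

text \<open>Both rates are read at the same \<open>s\<close>, the one with
  \<open>lam s = k / N\<close>; their sum is then one of the terms of the infimum, hence at least
  \<open>r\<close>.\<close>

lemma sum_coupon_le:
  assumes r: "trans_rate \<mu> = ereal r" and N: "N \<ge> 1" and k: "N \<le> k" "real k \<le> C * real N"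
  shows "fps_nth (pgf \<mu> ^ N) k * coupon (Suc N) k 1 \<le> exp (C + 1) * (C * real N) * exp (- real N * r)"
proof -
  let ?p = "fps_nth (pgf \<mu> ^ N) k"
  have N0: "real N > 0" using N by simp
  have p0: "?p \<ge> 0" by (simp add: pmf_sum_list_replicate[symmetric])
  have C0: "C * real N \<ge> 0" using k(2) by (rule order.trans[rotated]) simp
  show ?thesis
  proof (cases "?p = 0")
    case True
    then show ?thesis using C0 by simp
  next
    case False
    then have p: "?p > 0" using p0 by simp
    define x where "x = real k / real N"
    have x: "x \<ge> 1" "x \<le> C" using k N0 by (auto simp: x_def field_simps)
    obtain s where s: "0 \<le> s" "s \<le> x" "lam s = x" using lam_surj[OF x(1)] by blast
    have "ereal r \<le> rate_fun \<mu> (lam s) + ereal (coupon_rate s)"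
      unfolding r[symmetric] trans_rate_eq using s(1) by (intro INF_lower) simp
    also have "\<dots> \<le> ereal (- ln ?p / real N) + ereal (coupon_rate s)"
      unfolding s(3) x_def by (intro add_right_mono rate_fun_le_sum N p)
    finally have "r \<le> - ln ?p / real N + coupon_rate s" by simp
    then have "ln ?p \<le> real N * (coupon_rate s - r)" using N0 by (simp add: field_simps)
    then have "exp (ln ?p) \<le> exp (real N * (coupon_rate s - r))" by simp
    then have 1: "?p \<le> exp (real N * (coupon_rate s - r))" using p by simp
    have 2: "coupon (Suc N) k 1 \<le> exp (s + 1) * real k * exp (- real N * coupon_rate s)"
      by (rule coupon_le[OF N s(1)]) (use N0 in \<open>simp add: s(3) x_def\<close>)
    also have "\<dots> \<le> exp (C + 1) * (C * real N) * exp (- real N * coupon_rate s)"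
      using s(2) x(2) k(2) by (intro mult_right_mono mult_mono) auto
    finally have 2: "coupon (Suc N) k 1 \<le> exp (C + 1) * (C * real N) * exp (- real N * coupon_rate s)" .
    have "?p * coupon (Suc N) k 1 \<le> exp (real N * (coupon_rate s - r)) * (exp (C + 1) * (C * real N) * exp (- real N * coupon_rate s))"
      using coupon_bounds[of 1 "Suc N" k] by (intro mult_mono 1 2) auto
    also have "\<dots> = exp (C + 1) * (C * real N) * (exp (real N * (coupon_rate s - r)) * exp (- real N * coupon_rate s))"
      by simp
    also have "exp (real N * (coupon_rate s - r)) * exp (- real N * coupon_rate s) = exp (- real N * r)"
      by (simp add: exp_add[symmetric] algebra_simps)
    finally show ?thesis .
  qed
qed

text \<open>The condition on \<open>C\<close> makes the tail beyond \<open>C * N\<close> no larger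
  than \<open>exp (- N * r)\<close>, so that only polynomially many totals have to be compared with
  the infimum.\<close>

lemma prob_Trans_le:
  assumes ch: "server_chain M (Suc N) \<mu> X S" and r: "trans_rate \<mu> = ereal r" and N: "N \<ge> 1"
    and a: "a > 0" and fin: "exp_moment \<mu> a < \<infinity>" and C: "C \<ge> 1" "r + ln (enn2real (exp_moment \<mu> a)) \<le> a * C"
  shows "measure M (Trans M (Suc N) X S) \<le> (1 + (C * real N + 1) * (exp (C + 1) * (C * real N))) * exp (- real N * r)"
proof -
  interpret server_chain M "Suc N" \<mu> X S by (rule ch)
  let ?R = "replicate_pmf N \<mu>"
  let ?f = "enn2real (exp_moment \<mu> a)"
  have N0: "real N > 0" using N by simp
  have f: "?f > 0" by (rule exp_moment_sums(2)[OF fin])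
  define K where "K = {N..nat \<lfloor>C * real N\<rfloor>}"
  have K: "N \<le> k \<and> real k \<le> C * real N" if "k \<in> K" for k
    using that C N0 by (auto simp: K_def le_nat_iff le_floor_iff)
  have cnn: "coupon (Suc N) k 1 \<ge> 0" "coupon (Suc N) k 1 \<le> 1" for k using coupon_bounds[of 1 "Suc N" k] by auto
  have "emeasure M (Trans M (Suc N) X S) \<le> (\<integral>\<^sup>+ ks. ennreal (coupon (Suc N) (sum_list ks) 1) \<partial>?R)"
    using emeasure_Trans_le N by simp
  \<comment> \<open>Totals below \<open>N\<close> cannot succeed, totals from \<open>C * N\<close>
    on go to the tail bound, and at most \<open>C * N + 1\<close> values remain.\<close>
  also have "\<dots> \<le> (\<integral>\<^sup>+ ks. indicator {ks. C * real N \<le> real (sum_list ks)} ks +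
       (\<Sum>k\<in>K. ennreal (coupon (Suc N) k 1) * indicator {ks. sum_list ks = k} ks) \<partial>?R)"
  proof (intro nn_integral_mono)
    fix ks :: "nat list"
    let ?x = "sum_list ks"
    show "ennreal (coupon (Suc N) ?x 1) \<le> indicator {ks. C * real N \<le> real (sum_list ks)} ks +
       (\<Sum>k\<in>K. ennreal (coupon (Suc N) k 1) * indicator {ks. sum_list ks = k} ks)"
    proof -
      consider "?x < N" | "C * real N \<le> real ?x" | "?x \<in> K"
        by (cases "?x < N"; cases "C * real N \<le> real ?x") (auto simp: K_def le_nat_iff le_floor_iff)
      then show ?thesis
      proof cases
        case 1
        then show ?thesis using coupon_early[of "Suc N" 1 ?x] by simp
      next
        case 2
        have "ennreal (coupon (Suc N) ?x 1) \<le> 1" using cnn(2) ennreal_leI by fastforce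
        then show ?thesis using 2 by (simp add: add_increasing2)
      next
        case 3
        have "ennreal (coupon (Suc N) ?x 1) \<le> (\<Sum>k\<in>K. ennreal (coupon (Suc N) k 1) * indicator {ks. sum_list ks = k} ks)"
          by (rule order.trans[OF _ member_le_sum[OF 3]]) (auto simp: K_def)
        then show ?thesis by (simp add: add_increasing)
      qed
    qed
  qed
  also have "\<dots> = emeasure ?R {ks. C * real N \<le> real (sum_list ks)} +
      (\<Sum>k\<in>K. ennreal (coupon (Suc N) k 1) * emeasure ?R {ks. sum_list ks = k})"
    by (simp add: nn_integral_add nn_integral_sum nn_integral_cmult)
  also have "\<dots> = ennreal (measure ?R {ks. C * real N \<le> real (sum_list ks)} +
      (\<Sum>k\<in>K. coupon (Suc N) k 1 * measure ?R {ks. sum_list ks = k}))"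
    using cnn by (simp add: measure_pmf.emeasure_eq_measure ennreal_mult[symmetric] sum_nonneg)
  finally have "measure M (Trans M (Suc N) X S) \<le> measure ?R {ks. C * real N \<le> real (sum_list ks)} +
      (\<Sum>k\<in>K. coupon (Suc N) k 1 * measure ?R {ks. sum_list ks = k})"
    using cnn unfolding emeasure_eq_measure
    by (subst (asm) ennreal_le_iff) (auto intro!: add_nonneg_nonneg sum_nonneg mult_nonneg_nonneg)
  also have "\<dots> \<le> exp (- real N * r) + (\<Sum>k\<in>K. exp (C + 1) * (C * real N) * exp (- real N * r))"
  proof (intro add_mono sum_mono)
    have "measure ?R {ks. C * real N \<le> real (sum_list ks)} \<le> exp (- a * (C * real N)) * ?f ^ N"
      by (rule prob_sum_list_ge_le[OF a fin])
    also have "?f ^ N = exp (real N * ln ?f)" using f by (simp add: exp_of_nat_mult)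
    also have "exp (- a * (C * real N)) * exp (real N * ln ?f) = exp (real N * (ln ?f - a * C))"
      by (simp add: exp_add[symmetric] algebra_simps)
    also have "\<dots> \<le> exp (- real N * r)"
      unfolding exp_le_cancel_iff minus_mult_commute using C(2) by (intro mult_left_mono) auto
    finally show "measure ?R {ks. C * real N \<le> real (sum_list ks)} \<le> exp (- real N * r)" .
  next
    fix k assume "k \<in> K"
    note k = K[OF this]
    have "measure ?R {ks. sum_list ks = k} = measure (map_pmf sum_list ?R) {k}"
      by (simp add: vimage_def)
    also have "\<dots> = fps_nth (pgf \<mu> ^ N) k" by (simp only: measure_pmf_single pmf_sum_list_replicate)
    finally show "coupon (Suc N) k 1 * measure ?R {ks. sum_list ks = k} \<le> exp (C + 1) * (C * real N) * exp (- real N * r)"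
      using sum_coupon_le[OF r N, of k C] k by (simp add: mult.commute)
  qed
  also have "\<dots> \<le> exp (- real N * r) + (C * real N + 1) * (exp (C + 1) * (C * real N) * exp (- real N * r))"
  proof -
    have "card K \<le> nat \<lfloor>C * real N\<rfloor> + 1" by (simp add: K_def)
    moreover have "real (nat \<lfloor>C * real N\<rfloor>) \<le> C * real N" using C N0 by (intro of_nat_floor) auto
    ultimately have "real (card K) \<le> C * real N + 1" by linarith
    then show ?thesis using C N0 by (simp add: mult_right_mono)
  qed
  finally show ?thesis by (simp add: algebra_simps)
qed

text \<open>Attainment of the infimum is not at hand, so each \<open>s\<close> is treated
  separately; the number of draws is the least integer from \<open>lam s * N\<close> on.\<close>

lemma prob_Trans_ge_exp:
  assumes ch: "\<And>N. server_chain (M N) (Suc N) \<mu> (X N) (S N)"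
    and s: "s \<ge> 0" and I: "rate_fun \<mu> (lam s) \<le> ereal \<iota>" and \<epsilon>: "\<epsilon> > 0"
  shows "\<forall>\<^sub>F N in sequentially. exp (- real N * (\<iota> + coupon_rate s + \<epsilon>)) \<le>
    real N * (lam s * real N + 1) * measure (M N) (Trans (M N) (Suc N) (X N) (S N))"
proof -
  have e2: "\<epsilon> / 2 > 0" using \<epsilon> by simp
  have "\<forall>\<^sub>F N in sequentially. \<forall>k. lam s * real N \<le> real k \<longrightarrow>
    exp (- real N * (coupon_rate s + \<epsilon> / 2)) \<le> coupon (Suc N) k 1"
  proof (cases "s = 0")
    case True
    then show ?thesis using coupon_ge_0[OF e2] by (simp add: lam_def coupon_rate_0)
  next
    case False
    then show ?thesis using coupon_ge[OF _ e2, of s] s by simp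
  qed
  then show ?thesis using prob_sum_list_ge[OF lam_ge(1)[OF s] I e2] eventually_ge_at_top[of 1]
  proof eventually_elim
    case (elim N)
    interpret server_chain "M N" "Suc N" \<mu> "X N" "S N" by (rule ch)
    define k where "k = nat \<lceil>lam s * real N\<rceil>"
    have l: "lam s * real N \<ge> 0" using lam_ge(1)[OF s] by simp
    have k: "lam s * real N \<le> real k" "real k \<le> lam s * real N + 1"
      using l unfolding k_def by linarith+
    have "real N \<le> lam s * real N" using lam_ge(1)[OF s] by (simp add: mult_le_cancel_right1)
    then have kN: "N \<le> k" using k(1) by linarith
    have set_eq: "{ks. lam s * real N \<le> real (sum_list ks)} = {ks. k \<le> sum_list ks}"
      by (simp add: k_def nat_le_iff ceiling_le_iff)
    have "exp (- real N * (\<iota> + coupon_rate s + \<epsilon>)) = exp (- real N * (\<iota> + \<epsilon> / 2)) * exp (- real N * (coupon_rate s + \<epsilon> / 2))"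
      by (simp add: exp_add[symmetric] algebra_simps)
    also have "\<dots> \<le> measure (replicate_pmf N \<mu>) {ks. k \<le> sum_list ks} * coupon (Suc N) k 1"
      using elim k(1) unfolding set_eq by (intro mult_mono) auto
    also have "\<dots> \<le> real N * real k * measure (M N) (Trans (M N) (Suc N) (X N) (S N))"
      using prob_Trans_ge[of k] kN elim(3) by simp
    also have "\<dots> \<le> real N * (lam s * real N + 1) * measure (M N) (Trans (M N) (Suc N) (X N) (S N))"
      using k(2) by (intro mult_right_mono mult_left_mono) auto
    finally show ?case .
  qed
qed

theorem theorem2p8:
  fixes \<mu> :: "nat pmf" and a\<^sub>0 :: real
    and M :: "nat \<Rightarrow> 'a measure" and N S :: "nat \<Rightarrow> nat \<Rightarrow> 'a \<Rightarrow> nat"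
  assumes "pmf \<mu> 0 < 1" and "pmf \<mu> 1 < 1"
    and "\<And>n. n \<ge> 1 \<Longrightarrow> server_chain (M n) n \<mu> (N n) (S n)"
    and "a\<^sub>0 > 0" and "exp_moment \<mu> a\<^sub>0 < \<infinity>"
  shows "(\<lambda>n. eln (emeasure (M n) (Trans (M n) n (N n) (S n))) / ereal (real n))
           \<longlonglongrightarrow> - trans_rate \<mu> \<and>
         - \<infinity> < - trans_rate \<mu> \<and>
         - trans_rate \<mu> < 0"
proof -
  have pos: "trans_rate \<mu> > 0" by (rule trans_rate_pos[OF assms(4,5)])
  have fin: "trans_rate \<mu> < \<infinity>" by (rule trans_rate_finite[OF assms(1)])
  obtain r where r: "trans_rate \<mu> = ereal r" using pos fin by (cases "trans_rate \<mu>") auto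
  \<comment> \<open>Indexed by \<open>Suc n\<close>, as only \<open>n\<close> contributions then
    matter: the exponents carry \<open>n\<close>, the normalisation \<open>Suc n\<close>.\<close>
  define p where "p n = measure (M (Suc n)) (Trans (M (Suc n)) (Suc n) (N (Suc n)) (S (Suc n)))" for n
  have ch: "server_chain (M (Suc n)) (Suc n) \<mu> (N (Suc n)) (S (Suc n))" for n by (rule assms(3)) simp
  have low: "\<forall>\<^sub>F n in sequentially. p n > 0 \<and> a < ln (p n) / real (Suc n)" if a: "a < - r" for a
  proof -
    \<comment> \<open>One third each for approaching the infimum, for the loss in
      \<open>prob_Trans_ge_exp\<close> and for the strict inequality in the limit.\<close>
    define \<epsilon> where "\<epsilon> = (- r - a) / 3"
    have "3 * \<epsilon> = - r - a" by (simp add: \<epsilon>_def)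
    then have \<epsilon>: "\<epsilon> > 0" "a = - r - 3 * \<epsilon>" using a by linarith+
    have "(INF s\<in>{0::real..}. rate_fun \<mu> (lam s) + ereal (coupon_rate s)) < ereal (r + \<epsilon>)"
      unfolding trans_rate_eq[symmetric] r using \<epsilon>(1) by simp
    then obtain s where s: "s \<ge> 0" "rate_fun \<mu> (lam s) + ereal (coupon_rate s) < ereal (r + \<epsilon>)"
      unfolding INF_less_iff by auto
    then obtain \<iota> where \<iota>: "rate_fun \<mu> (lam s) = ereal \<iota>"
      using rate_fun_nonneg[of \<mu> "lam s"] by (cases "rate_fun \<mu> (lam s)") auto
    have sm: "\<iota> + coupon_rate s + \<epsilon> < r + 2 * \<epsilon>" using s(2) \<iota> by simp
    define l where "l = lam s"
    have l: "l \<ge> 1" using lam_ge(1)[OF s(1)] by (simp add: l_def)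
    have lim: "(\<lambda>n. (- real n * (r + 2 * \<epsilon>) - ln (real n * (l * real n + 1))) / real (Suc n)) \<longlonglongrightarrow> - (r + 2 * \<epsilon>)"
      using l by real_asymp
    have "\<forall>\<^sub>F n in sequentially. a < (- real n * (r + 2 * \<epsilon>) - ln (real n * (l * real n + 1))) / real (Suc n)"
      by (rule order_tendstoD(1)[OF lim]) (use \<epsilon> in simp)
    moreover have "\<forall>\<^sub>F n in sequentially. exp (- real n * (\<iota> + coupon_rate s + \<epsilon>)) \<le> real n * (l * real n + 1) * p n"
      unfolding p_def l_def by (rule prob_Trans_ge_exp[OF ch s(1) _ \<epsilon>(1)]) (simp add: \<iota>)
    ultimately show ?thesis using eventually_ge_at_top[of 1]
    proof eventually_elim
      case (elim n)
      have q: "real n * (l * real n + 1) > 0" using l elim by (intro mult_pos_pos add_nonneg_pos) auto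
      have "0 < real n * (l * real n + 1) * p n" using elim(2) by (rule less_le_trans[OF exp_gt_zero])
      then have pp: "p n > 0" using q by (simp add: zero_less_mult_iff)
      have "- real n * (r + 2 * \<epsilon>) \<le> - real n * (\<iota> + coupon_rate s + \<epsilon>)"
        unfolding minus_mult_commute using sm by (intro mult_left_mono) auto
      also have "\<dots> \<le> ln (real n * (l * real n + 1) * p n)"
        using elim(2) q pp by (subst ln_ge_iff) auto
      also have "\<dots> = ln (real n * (l * real n + 1)) + ln (p n)" using q pp by (intro ln_mult_pos)
      finally have "- real n * (r + 2 * \<epsilon>) - ln (real n * (l * real n + 1)) \<le> ln (p n)" by simp
      then have "(- real n * (r + 2 * \<epsilon>) - ln (real n * (l * real n + 1))) / real (Suc n) \<le> ln (p n) / real (Suc n)"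
        by (rule divide_right_mono) simp
      then show ?case using elim(1) pp by linarith
    qed
  qed
  \<comment> \<open>\<open>ln 0\<close> is \<open>0\<close> for reals while \<open>eln 0\<close> is
    \<open>-\<infinity>\<close>, so positivity is needed before one is exchanged for the
    other.\<close>
  have ppos: "\<forall>\<^sub>F n in sequentially. p n > 0" using low[of "- r - 1"] by (auto elim: eventually_mono)
  have "(\<lambda>n. ln (p n) / real (Suc n)) \<longlonglongrightarrow> - r"
  proof (rule order_tendstoI)
    fix a assume "a < - r"
    from low[OF this] show "\<forall>\<^sub>F n in sequentially. a < ln (p n) / real (Suc n)" by (auto elim: eventually_mono)
  next
    fix a assume a: "- r < a"
    \<comment> \<open>Large enough for the tail bound of \<open>prob_Trans_le\<close> with the
      exponential moment at \<open>a\<^sub>0\<close>.\<close>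
    define C where "C = max 1 ((r + ln (enn2real (exp_moment \<mu> a\<^sub>0))) / a\<^sub>0)"
    have C1: "C \<ge> 1" by (simp add: C_def)
    have "(r + ln (enn2real (exp_moment \<mu> a\<^sub>0))) / a\<^sub>0 \<le> C" by (simp add: C_def)
    then have C2: "r + ln (enn2real (exp_moment \<mu> a\<^sub>0)) \<le> a\<^sub>0 * C" using assms(4) by (simp add: field_simps)
    define D where "D = exp (C + 1)"
    have D: "D > 0" by (simp add: D_def)
    have lim: "(\<lambda>n. (ln (1 + (C * real n + 1) * (D * (C * real n))) - real n * r) / real (Suc n)) \<longlonglongrightarrow> - r"
      using C1 D by real_asymp
    show "\<forall>\<^sub>F n in sequentially. ln (p n) / real (Suc n) < a"
      using order_tendstoD(2)[OF lim a] ppos eventually_ge_at_top[of 1]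
    proof eventually_elim
      case (elim n)
      have q: "1 + (C * real n + 1) * (D * (C * real n)) > 0" using C1 D by (intro add_pos_nonneg) auto
      have "p n \<le> (1 + (C * real n + 1) * (D * (C * real n))) * exp (- real n * r)"
        unfolding p_def D_def by (rule prob_Trans_le[OF ch r elim(3) assms(4,5) C1 C2])
      then have "ln (p n) \<le> ln ((1 + (C * real n + 1) * (D * (C * real n))) * exp (- real n * r))"
        using elim(2) q by (subst ln_le_cancel_iff) auto
      also have "\<dots> = ln (1 + (C * real n + 1) * (D * (C * real n))) + - real n * r"
        using q by (subst ln_mult_pos) auto
      finally have "ln (p n) / real (Suc n) \<le> (ln (1 + (C * real n + 1) * (D * (C * real n))) - real n * r) / real (Suc n)"
        by (intro divide_right_mono) auto
      then show ?case using elim(1) by linarith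
    qed
  qed
  then have "(\<lambda>n. ereal (ln (p n) / real (Suc n))) \<longlonglongrightarrow> ereal (- r)" by simp
  moreover have "\<forall>\<^sub>F n in sequentially. ereal (ln (p n) / real (Suc n)) =
    eln (emeasure (M (Suc n)) (Trans (M (Suc n)) (Suc n) (N (Suc n)) (S (Suc n)))) / ereal (real (Suc n))"
    using ppos
  proof eventually_elim
    case (elim n)
    interpret server_chain "M (Suc n)" "Suc n" \<mu> "N (Suc n)" "S (Suc n)" by (rule ch)
    have "emeasure (M (Suc n)) (Trans (M (Suc n)) (Suc n) (N (Suc n)) (S (Suc n))) = ennreal (p n)"
      unfolding p_def by (rule emeasure_eq_measure)
    moreover have "eln (ennreal (p n)) = ereal (ln (p n))" using elim by (auto simp: eln_def)
    ultimately show ?case by simp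
  qed
  ultimately have "(\<lambda>n. eln (emeasure (M (Suc n)) (Trans (M (Suc n)) (Suc n) (N (Suc n)) (S (Suc n)))) / ereal (real (Suc n)))
      \<longlonglongrightarrow> ereal (- r)"
    by (rule Lim_transform_eventually)
  then have "(\<lambda>n. eln (emeasure (M n) (Trans (M n) n (N n) (S n))) / ereal (real n)) \<longlonglongrightarrow> ereal (- r)"
    by (rule filterlim_sequentially_Suc[THEN iffD1])
  then show ?thesis using pos by (simp add: r)
qed

end
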